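(* Let $\rho=(r_n)_n$ be an increasing sequence in $[0,1)$ converging to $1$ as $n\to\infty$. There exists a residual set of functions $f\in H(\mathbb{D})$ such that $f\circ\Phi\in\mathcal{U}_A(\mathbb{D},\rho)$ for every automorphism $\Phi$ of the unit disc $\mathbb{D}$.
   Context: $\mathbb{D}$ is the open unit disc, $\mathbb{T}=\partial\mathbb{D}$ the unit circle, and $H(\mathbb{D})$ the space of holomorphic functions on $\mathbb{D}$ endowed with the topology of local uniform convergence. A subset of $H(\mathbb{D})$ is residual if it contains a dense $G_\delta$ subset of $H(\mathbb{D})$. An automorphism of $\mathbb{D}$ is a holomorphic bijection $\mathbb{D}\to\mathbb{D}$. For an increasing sequence $\rho=(r_n)_n$ in $[0,1)$ with $r_n\to1$, $\mathcal{U}_A(\mathbb{D},\rho)$ denotes the set of all $f\in H(\mathbb{D})$ such that: for any compact subset $K\subset\mathbb{T}$, $K\neq\mathbb{T}$, and any continuous function $\varphi:K\to\mathbb{C}$, there exists an increasing sequence $(n_k)_k$ in $\mathbb{N}$ such that $\sup_{\zeta\in K}|f(r_{n_k}\zeta)-\varphi(\zeta)|\to0$ as $k\to\infty$. *)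

theory Defs
  imports "HOL-Complex_Analysis.Complex_Analysis"
begin

text \<open>
  The open unit disc is \<open>ball 0 1\<close> and the unit circle is \<open>sphere 0 1\<close>.  Since functions in HOL
  are total, elements of $H(D)$ are represented by functions that are \<open>extensional\<close> on the disc
  (equal to \<open>undefined\<close> outside), so that HOL equality is equality of functions on the disc.
\<close>

definition hol_disc :: "(complex \<Rightarrow> complex) set" where
  "hol_disc = {f. f holomorphic_on ball 0 1} \<inter> extensional (ball 0 1)"

definition hol_nbhd :: "(complex \<Rightarrow> complex) \<Rightarrow> complex set \<Rightarrow> real \<Rightarrow> (complex \<Rightarrow> complex) set" where
  "hol_nbhd f K e = {g \<in> hol_disc. \<forall>z\<in>K. dist (g z) (f z) < e}"

text \<open>The topology of local uniform convergence, i.e. of uniform convergence on compact subsets of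
  the disc; see \<open>limitin_hol_top\<close> below.\<close>

definition hol_top :: "(complex \<Rightarrow> complex) topology" where
  "hol_top = topology (\<lambda>U. U \<subseteq> hol_disc \<and>
     (\<forall>f\<in>U. \<exists>K e. compact K \<and> K \<subseteq> ball 0 1 \<and> e > 0 \<and> hol_nbhd f K e \<subseteq> U))"

lemma hol_nbhd_Int: "hol_nbhd f (K \<union> L) (min d e) \<subseteq> hol_nbhd f K d \<inter> hol_nbhd f L e"
  by (auto simp: hol_nbhd_def)

lemma openin_hol_top:
  "openin hol_top U \<longleftrightarrow> U \<subseteq> hol_disc \<and>
     (\<forall>f\<in>U. \<exists>K e. compact K \<and> K \<subseteq> ball 0 1 \<and> e > 0 \<and> hol_nbhd f K e \<subseteq> U)"
proof -
  have "istopology (\<lambda>U. U \<subseteq> hol_disc \<and>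
     (\<forall>f\<in>U. \<exists>K e. compact K \<and> K \<subseteq> ball 0 1 \<and> e > 0 \<and> hol_nbhd f K e \<subseteq> U))"
    unfolding istopology_def
  proof (intro conjI allI impI)
    fix S T
    assume S: "S \<subseteq> hol_disc \<and>
        (\<forall>f\<in>S. \<exists>K e. compact K \<and> K \<subseteq> ball 0 1 \<and> e > 0 \<and> hol_nbhd f K e \<subseteq> S)"
      and T: "T \<subseteq> hol_disc \<and>
        (\<forall>f\<in>T. \<exists>K e. compact K \<and> K \<subseteq> ball 0 1 \<and> e > 0 \<and> hol_nbhd f K e \<subseteq> T)"
    show "S \<inter> T \<subseteq> hol_disc" using S by blast
    show "\<forall>f\<in>S \<inter> T. \<exists>K e. compact K \<and> K \<subseteq> ball 0 1 \<and> e > 0 \<and> hol_nbhd f K e \<subseteq> S \<inter> T"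
    proof
      fix f assume f: "f \<in> S \<inter> T"
      obtain K d where K: "compact K" "K \<subseteq> ball 0 1" "d > 0" "hol_nbhd f K d \<subseteq> S"
        using S f by blast
      obtain L e where L: "compact L" "L \<subseteq> ball 0 1" "e > 0" "hol_nbhd f L e \<subseteq> T"
        using T f by blast
      have "hol_nbhd f (K \<union> L) (min d e) \<subseteq> S \<inter> T"
        using hol_nbhd_Int[of f K L d e] K L by blast
      then show "\<exists>K e. compact K \<and> K \<subseteq> ball 0 1 \<and> e > 0 \<and> hol_nbhd f K e \<subseteq> S \<inter> T"
        using K L by (intro exI[of _ "K \<union> L"] exI[of _ "min d e"]) (simp add: compact_Un)
    qed
  next
    fix \<K>
    assume *: "\<forall>S\<in>\<K>. S \<subseteq> hol_disc \<and>
        (\<forall>f\<in>S. \<exists>K e. compact K \<and> K \<subseteq> ball 0 1 \<and> e > 0 \<and> hol_nbhd f K e \<subseteq> S)"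
    show "\<Union>\<K> \<subseteq> hol_disc" using * by blast
    show "\<forall>f\<in>\<Union>\<K>. \<exists>K e. compact K \<and> K \<subseteq> ball 0 1 \<and> e > 0 \<and> hol_nbhd f K e \<subseteq> \<Union>\<K>"
      using * by (meson UnionE Union_upper subset_trans)
  qed
  then show ?thesis
    by (simp add: hol_top_def topology_inverse')
qed

lemma topspace_hol_top [simp]: "topspace hol_top = hol_disc"
proof
  show "topspace hol_top \<subseteq> hol_disc"
    using openin_topspace[of hol_top] unfolding openin_hol_top by blast
  have "openin hol_top hol_disc"
    unfolding openin_hol_top
    by (auto simp: hol_nbhd_def intro!: exI[of _ "{}"] exI[of _ "1::real"])
  then show "hol_disc \<subseteq> topspace hol_top" by (rule openin_subset)
qed

lemma hol_nbhd_refl: "f \<in> hol_disc \<Longrightarrow> e > 0 \<Longrightarrow> f \<in> hol_nbhd f K e"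
  by (simp add: hol_nbhd_def)

lemma openin_hol_nbhd:
  assumes f: "f \<in> hol_disc" and K: "compact K" "K \<subseteq> ball 0 1"
  shows "openin hol_top (hol_nbhd f K e)"
  unfolding openin_hol_top
proof (intro conjI ballI)
  show "hol_nbhd f K e \<subseteq> hol_disc" by (auto simp: hol_nbhd_def)
  fix g assume g: "g \<in> hol_nbhd f K e"
  have cont: "continuous_on K (\<lambda>z. dist (g z) (f z))"
    using f g K unfolding hol_nbhd_def hol_disc_def
    by (intro continuous_on_dist)
       (auto intro: continuous_on_subset dest!: holomorphic_on_imp_continuous_on)
  obtain d where d: "d > 0" "\<And>z. z \<in> K \<Longrightarrow> dist (g z) (f z) + d \<le> e"
  proof (cases "K = {}")
    case False
    obtain w where w: "w \<in> K" "\<And>z. z \<in> K \<Longrightarrow> dist (g z) (f z) \<le> dist (g w) (f w)"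
      using continuous_attains_sup[OF K(1) False cont] by blast
    show ?thesis
    proof (rule that)
      show "e - dist (g w) (f w) > 0" using g w(1) by (auto simp: hol_nbhd_def)
      show "dist (g z) (f z) + (e - dist (g w) (f w)) \<le> e" if "z \<in> K" for z
        using w(2)[OF that] by simp
    qed
  qed (use that[of 1] in auto)
  have "hol_nbhd g K d \<subseteq> hol_nbhd f K e"
  proof
    fix h assume h: "h \<in> hol_nbhd g K d"
    have "dist (h z) (f z) < e" if "z \<in> K" for z
    proof -
      have "dist (h z) (g z) < d" using h that by (auto simp: hol_nbhd_def)
      then show ?thesis
        using d(2)[OF that] dist_triangle[of "h z" "f z" "g z"] by linarith
    qed
    then show "h \<in> hol_nbhd f K e" using h by (auto simp: hol_nbhd_def)
  qed
  then show "\<exists>K' e'. compact K' \<and> K' \<subseteq> ball 0 1 \<and> e' > 0 \<and> hol_nbhd g K' e' \<subseteq> hol_nbhd f K e"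
    using K d(1) by blast
qed

lemma limitin_hol_top:
  "limitin hol_top g f F \<longleftrightarrow>
     f \<in> hol_disc \<and> eventually (\<lambda>x. g x \<in> hol_disc) F \<and>
     (\<forall>K. compact K \<and> K \<subseteq> ball 0 1 \<longrightarrow> uniform_limit K g f F)"
proof (intro iffI conjI allI impI)
  assume lim: "limitin hol_top g f F"
  show f: "f \<in> hol_disc" using lim by (simp add: limitin_def)
  show "eventually (\<lambda>x. g x \<in> hol_disc) F"
    using lim f openin_topspace[of hol_top] by (auto simp: limitin_def)
  fix K assume K: "compact K \<and> K \<subseteq> ball (0::complex) 1"
  show "uniform_limit K g f F"
    unfolding uniform_limit_iff
  proof (intro allI impI)
    fix e :: real assume "e > 0"
    then have "eventually (\<lambda>x. g x \<in> hol_nbhd f K e) F"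
      using lim openin_hol_nbhd[of f K e] hol_nbhd_refl[of f e K] f K
      by (simp add: limitin_def)
    then show "eventually (\<lambda>x. \<forall>z\<in>K. dist (g x z) (f z) < e) F"
      by eventually_elim (simp add: hol_nbhd_def)
  qed
next
  assume *: "f \<in> hol_disc \<and> eventually (\<lambda>x. g x \<in> hol_disc) F \<and>
     (\<forall>K. compact K \<and> K \<subseteq> ball 0 1 \<longrightarrow> uniform_limit K g f F)"
  show "limitin hol_top g f F"
    unfolding limitin_def
  proof (intro conjI allI impI)
    show "f \<in> topspace hol_top" using * by simp
    fix U assume "openin hol_top U \<and> f \<in> U"
    then obtain K e where K: "compact K" "K \<subseteq> ball 0 1" "e > 0" "hol_nbhd f K e \<subseteq> U"
      unfolding openin_hol_top by blast
    have "eventually (\<lambda>x. \<forall>z\<in>K. dist (g x z) (f z) < e) F"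
      using * K by (simp add: uniform_limit_iff)
    moreover have "eventually (\<lambda>x. g x \<in> hol_disc) F" using * by blast
    ultimately show "eventually (\<lambda>x. g x \<in> U) F"
      by eventually_elim (use K(4) in \<open>auto simp: hol_nbhd_def\<close>)
  qed
qed

definition residual_in :: "'a topology \<Rightarrow> 'a set \<Rightarrow> bool" where
  "residual_in X S \<longleftrightarrow> S \<subseteq> topspace X \<and>
     (\<exists>G\<subseteq>S. gdelta_in X G \<and> X closure_of G = topspace X)"

definition disc_automorphism :: "(complex \<Rightarrow> complex) \<Rightarrow> bool" where
  "disc_automorphism \<Phi> \<longleftrightarrow>
     \<Phi> holomorphic_on ball 0 1 \<and> bij_betw \<Phi> (ball 0 1) (ball 0 1)"

text \<open>
  Convergence to 0 of $\sup_{\zeta\in K} |f(r_{n_k}\zeta) - \varphi(\zeta)|$ is \<open>uniform_limit\<close>,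
  which also covers \<open>K = {}\<close>, where the real-valued supremum is unspecified; see
  \<open>uniform_limit_iff_SUP\<close> below.
\<close>

definition UA_disc :: "(nat \<Rightarrow> real) \<Rightarrow> (complex \<Rightarrow> complex) set" where
  "UA_disc r = {f \<in> hol_disc.
     \<forall>K \<phi>. compact K \<and> K \<subseteq> sphere 0 1 \<and> K \<noteq> sphere 0 1 \<and> continuous_on K \<phi> \<longrightarrow>
       (\<exists>n. strict_mono n \<and>
          uniform_limit K (\<lambda>k \<zeta>. f (of_real (r (n k)) * \<zeta>)) \<phi> sequentially)}"

lemma uniform_limit_iff_SUP:
  fixes g :: "nat \<Rightarrow> 'a::topological_space \<Rightarrow> 'b::real_normed_vector"
  assumes "compact K" "K \<noteq> {}" "\<And>k. continuous_on K (g k)" "continuous_on K \<phi>"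
  shows "uniform_limit K g \<phi> sequentially \<longleftrightarrow>
           (\<lambda>k. SUP \<zeta>\<in>K. norm (g k \<zeta> - \<phi> \<zeta>)) \<longlonglongrightarrow> 0"
proof -
  let ?s = "\<lambda>k. SUP \<zeta>\<in>K. norm (g k \<zeta> - \<phi> \<zeta>)"
  have bdd: "bdd_above ((\<lambda>\<zeta>. norm (g k \<zeta> - \<phi> \<zeta>)) ` K)" for k
    using assms
    by (intro bounded_imp_bdd_above compact_imp_bounded compact_continuous_image
        continuous_intros) auto
  have upper: "norm (g k \<zeta> - \<phi> \<zeta>) \<le> ?s k" if "\<zeta> \<in> K" for k \<zeta>
    by (rule cSUP_upper[OF that bdd])
  have nonneg: "0 \<le> ?s k" for k
  proof -
    obtain \<zeta> where "\<zeta> \<in> K" using assms(2) by blast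
    then show ?thesis using upper[of \<zeta> k] norm_ge_zero[of "g k \<zeta> - \<phi> \<zeta>"] by linarith
  qed
  show ?thesis
  proof
    assume u: "uniform_limit K g \<phi> sequentially"
    show "?s \<longlonglongrightarrow> 0"
    proof (rule tendstoI)
      fix e :: real assume "e > 0"
      then have "eventually (\<lambda>k. \<forall>\<zeta>\<in>K. dist (g k \<zeta>) (\<phi> \<zeta>) < e / 2) sequentially"
        using u unfolding uniform_limit_iff by (meson half_gt_zero)
      then show "eventually (\<lambda>k. dist (?s k) 0 < e) sequentially"
      proof eventually_elim
        case (elim k)
        have "?s k \<le> e / 2"
          using elim by (intro cSUP_least[OF assms(2)]) (auto simp: dist_norm less_imp_le)
        then show ?case using nonneg[of k] \<open>e > 0\<close> by simp
      qed
    qed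
  next
    assume s: "?s \<longlonglongrightarrow> 0"
    show "uniform_limit K g \<phi> sequentially"
      unfolding uniform_limit_iff
    proof (intro allI impI)
      fix e :: real assume "e > 0"
      then have "eventually (\<lambda>k. ?s k < e) sequentially"
        using s by (simp add: order_tendstoD(2))
      then show "eventually (\<lambda>k. \<forall>\<zeta>\<in>K. dist (g k \<zeta>) (\<phi> \<zeta>) < e) sequentially"
      proof eventually_elim
        case (elim k)
        show ?case
        proof
          fix \<zeta> assume "\<zeta> \<in> K"
          then show "dist (g k \<zeta>) (\<phi> \<zeta>) < e"
            using upper[of \<zeta> k] elim unfolding dist_norm by linarith
        qed
      qed
    qed
  qed
qed

end

theory Submission
  imports Defs "HOL-Computational_Algebra.Fundamental_Theorem_Algebra"
begin

text \<open>
  A function \<open>\<phi> \<circ> \<Phi>\<^sup>-\<^sup>1\<close> on a proper compact subset of the circle is a uniform limit of polynomials, so it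
  suffices that \<open>f\<close> is close to a prescribed polynomial \<open>q\<close> at the points \<open>\<Phi> (r\<^sub>n \<zeta>)\<close>.  As \<open>\<Phi>\<close> extends to a
  bi-Lipschitz map of the closed disc, these points lie in an annulus
  \<open>1 - c (1 - r\<^sub>n) \<le> |z| \<le> 1 - (1 - r\<^sub>n) / c\<close> away from some point \<open>p\<close> of the circle, where only \<open>c\<close> and
  \<open>p\<close> depend on \<open>\<Phi>\<close>.  Thus uncountably many automorphisms are controlled by countably many open conditions:
  \<open>f\<close> is close to \<open>q\<close> on the cut annulus for some large \<open>n\<close>.  Each condition is dense: by pole pushing
  there is a polynomial \<open>h\<close> close to 0 on a disc \<open>|z| \<le> s\<close> and close to 1 on the circle away from \<open>p\<close>, and
  \<open>g + h (q - g)\<close>, with \<open>g\<close> a dilate of the given function, is close to \<open>g\<close> on the disc and to \<open>q\<close>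
  on the cut annulus.  Baire's theorem finishes the proof.
\<close>

subsection \<open>Polynomial approximation by pole pushing\<close>

text \<open>For compact \<open>K\<close> this is membership in the uniform closure of the
  polynomials; the lemmas that follow make it an algebra closed under uniform limits.\<close>

definition poly_approximable :: "complex set \<Rightarrow> (complex \<Rightarrow> complex) \<Rightarrow> bool" where
  "poly_approximable K f \<longleftrightarrow> (\<forall>e>0. \<exists>p. \<forall>z\<in>K. cmod (f z - poly p z) < e)"

lemma poly_approximable_poly: "poly_approximable K (poly p)"
  unfolding poly_approximable_def by (intro allI impI exI[of _ p]) auto

lemma poly_approximable_const: "poly_approximable K (\<lambda>_. c)"
  using poly_approximable_poly[of K "[:c:]"] by (simp add: poly_approximable_def)

lemma poly_approximable_id: "poly_approximable K (\<lambda>z. z)"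
  using poly_approximable_poly[of K "[:0, 1:]"] by (simp add: poly_approximable_def)

lemma poly_approximable_cong:
  assumes "poly_approximable K f" "\<And>z. z \<in> K \<Longrightarrow> f z = g z"
  shows "poly_approximable K g"
  using assms unfolding poly_approximable_def by metis

lemma poly_approximable_add:
  assumes "poly_approximable K f" "poly_approximable K g"
  shows "poly_approximable K (\<lambda>z. f z + g z)"
  unfolding poly_approximable_def
proof (intro allI impI)
  fix e :: real assume e: "e > 0"
  obtain p where p: "\<And>z. z \<in> K \<Longrightarrow> cmod (f z - poly p z) < e / 2"
    using assms(1) e unfolding poly_approximable_def by (meson half_gt_zero)
  obtain q where q: "\<And>z. z \<in> K \<Longrightarrow> cmod (g z - poly q z) < e / 2"
    using assms(2) e unfolding poly_approximable_def by (meson half_gt_zero)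
  have "cmod (f z + g z - poly (p + q) z) < e" if "z \<in> K" for z
    using norm_add_less[OF p[OF that] q[OF that]] by (simp add: algebra_simps)
  then show "\<exists>p. \<forall>z\<in>K. cmod (f z + g z - poly p z) < e" by blast
qed

lemma poly_approximable_bounded:
  assumes "compact K" "poly_approximable K f"
  obtains B where "B > 0" "\<And>z. z \<in> K \<Longrightarrow> cmod (f z) \<le> B"
proof -
  obtain p where p: "\<And>z. z \<in> K \<Longrightarrow> cmod (f z - poly p z) < 1"
    using assms(2) unfolding poly_approximable_def by (meson zero_less_one)
  have "bounded (poly p ` K)"
    by (intro compact_imp_bounded compact_continuous_image assms continuous_intros)
  then obtain B where B: "B > 0" "\<And>z. z \<in> K \<Longrightarrow> cmod (poly p z) \<le> B"
    unfolding bounded_pos by auto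
  show ?thesis
  proof (rule that[of "B + 1"])
    show "cmod (f z) \<le> B + 1" if "z \<in> K" for z
      using p[OF that] B(2)[OF that] norm_triangle_ineq2[of "f z" "poly p z"] by linarith
  qed (use B in simp)
qed

lemma poly_approximable_mult:
  assumes K: "compact K" and f: "poly_approximable K f" and g: "poly_approximable K g"
  shows "poly_approximable K (\<lambda>z. f z * g z)"
  unfolding poly_approximable_def
proof (intro allI impI)
  fix e :: real assume e: "e > 0"
  obtain B where B: "B > 0" "\<And>z. z \<in> K \<Longrightarrow> cmod (f z) \<le> B"
    using poly_approximable_bounded[OF K f] by blast
  \<comment> \<open>\<open>q\<close> is chosen before \<open>p\<close>: the tolerance for
    \<open>p\<close> involves the bound \<open>C\<close> of \<open>q\<close> on \<open>K\<close>,
    while \<open>B\<close> bounds \<open>f\<close> itself.\<close>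
  obtain q where q: "\<And>z. z \<in> K \<Longrightarrow> cmod (g z - poly q z) < e / (2 * B)"
    using g e B unfolding poly_approximable_def
    by (meson zero_less_divide_iff zero_less_mult_iff zero_less_numeral)
  obtain C where C: "C > 0" "\<And>z. z \<in> K \<Longrightarrow> cmod (poly q z) \<le> C"
    using poly_approximable_bounded[OF K poly_approximable_poly] by blast
  obtain p where p: "\<And>z. z \<in> K \<Longrightarrow> cmod (f z - poly p z) < e / (2 * C)"
    using f e C unfolding poly_approximable_def
    by (meson zero_less_divide_iff zero_less_mult_iff zero_less_numeral)
  have "cmod (f z * g z - poly (p * q) z) < e" if z: "z \<in> K" for z
  proof -
    have "f z * g z - poly (p * q) z = f z * (g z - poly q z) + (f z - poly p z) * poly q z"
      by (simp add: algebra_simps)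
    moreover have "cmod (f z * (g z - poly q z)) \<le> B * cmod (g z - poly q z)"
      using B(2)[OF z] by (simp add: norm_mult mult_right_mono)
    moreover have "B * cmod (g z - poly q z) < e / 2"
      using q[OF z] B(1) by (simp add: field_simps)
    moreover have "cmod ((f z - poly p z) * poly q z) \<le> cmod (f z - poly p z) * C"
      using C(2)[OF z] by (simp add: norm_mult mult_left_mono)
    moreover have "cmod (f z - poly p z) * C < e / 2"
      using p[OF z] C(1) by (simp add: field_simps)
    ultimately show ?thesis
      by (smt (verit) norm_triangle_ineq field_sum_of_halves)
  qed
  then show "\<exists>p. \<forall>z\<in>K. cmod (f z * g z - poly p z) < e" by blast
qed

lemma poly_approximable_closure:
  assumes "\<And>e. e > 0 \<Longrightarrow> \<exists>g. poly_approximable K g \<and> (\<forall>z\<in>K. cmod (f z - g z) < e)"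
  shows "poly_approximable K f"
  unfolding poly_approximable_def
proof (intro allI impI)
  fix e :: real assume e: "e > 0"
  obtain g where g: "poly_approximable K g" "\<And>z. z \<in> K \<Longrightarrow> cmod (f z - g z) < e / 2"
    using assms[of "e / 2"] e by auto
  obtain p where p: "\<And>z. z \<in> K \<Longrightarrow> cmod (g z - poly p z) < e / 2"
    using g(1) e unfolding poly_approximable_def by (meson half_gt_zero)
  have "cmod (f z - poly p z) < e" if "z \<in> K" for z
    using norm_diff_triangle_less[OF g(2)[OF that] p[OF that]] by simp
  then show "\<exists>p. \<forall>z\<in>K. cmod (f z - poly p z) < e" by blast
qed

lemma poly_approximable_power:
  assumes "compact K" "poly_approximable K f"
  shows "poly_approximable K (\<lambda>z. f z ^ n)"
  by (induction n) (simp_all add: poly_approximable_const poly_approximable_mult assms)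

lemma poly_approximable_sum:
  assumes "\<And>i. poly_approximable K (f i)"
  shows "poly_approximable K (\<lambda>z. \<Sum>i<(n::nat). f i z)"
  by (induction n) (simp_all add: poly_approximable_const poly_approximable_add assms)

section \<open>Rational functions and the displacement of their poles\<close>

lemma poly_approximable_geometric:
  assumes K: "compact K" and u: "poly_approximable K u"
    and q: "q < 1" "\<And>z. z \<in> K \<Longrightarrow> cmod (u z) \<le> q"
  shows "poly_approximable K (\<lambda>z. 1 / (1 - u z))"
proof (cases "K = {}")
  case False
  then have q0: "q \<ge> 0" using q(2) norm_ge_zero order_trans by blast
  show ?thesis
  proof (rule poly_approximable_closure)
    fix e :: real assume e: "e > 0"
    \<comment> \<open>The partial sum of the geometric series leaves a tail of modulus at most
      \<open>q ^ n / (1 - q)\<close>.\<close>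
    obtain n where n: "q ^ n < e * (1 - q)"
      using real_arch_pow_inv[of "e * (1 - q)" q] e q by auto
    have "cmod (1 / (1 - u z) - (\<Sum>i<n. u z ^ i)) < e" if z: "z \<in> K" for z
    proof -
      have u1: "u z \<noteq> 1" using q(2)[OF z] q(1) by auto
      have "1 / (1 - u z) - (\<Sum>i<n. u z ^ i) = u z ^ n / (1 - u z)"
        using u1 by (simp add: geometric_sum divide_simps) (simp add: algebra_simps)
      then have "cmod (1 / (1 - u z) - (\<Sum>i<n. u z ^ i)) = cmod (u z) ^ n / cmod (1 - u z)"
        by (simp add: norm_divide norm_power)
      also have "\<dots> \<le> q ^ n / (1 - q)"
      proof (rule frac_le)
        show "cmod (u z) ^ n \<le> q ^ n" by (intro power_mono q(2) z) simp
        show "1 - q \<le> cmod (1 - u z)"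
          using q(2)[OF z] norm_triangle_ineq2[of 1 "u z"] by simp
      qed (use q q0 in auto)
      also have "\<dots> < e" using n q(1) by (simp add: field_simps)
      finally show ?thesis .
    qed
    moreover have "poly_approximable K (\<lambda>z. \<Sum>i<n. u z ^ i)"
      by (intro poly_approximable_sum poly_approximable_power K u)
    ultimately show "\<exists>g. poly_approximable K g \<and> (\<forall>z\<in>K. cmod (1 / (1 - u z) - g z) < e)"
      by blast
  qed
qed (simp add: poly_approximable_def)

text \<open>Here \<open>1 / (z - a)\<close> is \<open>- 1 / a\<close> times the geometric series in
  \<open>z / a\<close>, whose ratio has modulus at most \<open>q / cmod a < 1\<close> on
  \<open>K\<close>.\<close>

lemma poly_approximable_far_pole:
  assumes K: "compact K" and a: "\<And>z. z \<in> K \<Longrightarrow> cmod z \<le> q" "q < cmod a"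
  shows "poly_approximable K (\<lambda>z. 1 / (z - a))"
proof (cases "K = {}")
  case False
  then have "q \<ge> 0" using a(1) norm_ge_zero order_trans by blast
  then have a0: "a \<noteq> 0" using a(2) by auto
  have "poly_approximable K (\<lambda>z. z * (1 / a))"
    by (intro poly_approximable_mult K poly_approximable_id poly_approximable_const)
  then have "poly_approximable K (\<lambda>z. 1 / (1 - z * (1 / a)))"
    by (rule poly_approximable_geometric[OF K, of _ "q / cmod a"])
       (use a a0 in \<open>auto simp: norm_divide divide_simps\<close>)
  then have "poly_approximable K (\<lambda>z. - (1 / a) * (1 / (1 - z * (1 / a))))"
    by (intro poly_approximable_mult K poly_approximable_const)
  then show ?thesis
  proof (rule poly_approximable_cong)
    fix z assume "z \<in> K"
    then have "z \<noteq> a" using a by force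
    then show "- (1 / a) * (1 / (1 - z * (1 / a))) = 1 / (z - a)"
      using a0 by (simp add: divide_simps)
  qed
qed (simp add: poly_approximable_def)

text \<open>The heart of Runge's theorem: approximability is locally constant in the pole, since
  \<open>1 / (z - y)\<close> equals \<open>1 / (z - x)\<close> times a geometric series in
  \<open>(y - x) / (z - x)\<close>. Connectedness of \<open>E\<close> carries it from
  \<open>a\<close> to \<open>b\<close>.\<close>

lemma poly_approximable_push_pole:
  assumes K: "compact K" and E: "connected E" "E \<inter> K = {}" "a \<in> E" "b \<in> E"
    and a: "poly_approximable K (\<lambda>z. 1 / (z - a))"
  shows "poly_approximable K (\<lambda>z. 1 / (z - b))"
proof (cases "K = {}")
  case False
  show ?thesis
  proof (rule connected_induction_simple[where P = "\<lambda>c. poly_approximable K (\<lambda>z. 1 / (z - c))",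
        OF E(1) E(3,4) a])
    fix c assume c: "c \<in> E"
    define d where "d = infdist c K"
    have d: "d > 0"
      using infdist_pos_not_in_closed[of K c] K c E(2) False
      by (auto simp: d_def compact_imp_closed)
    have dz: "cmod (z - c) \<ge> d" if "z \<in> K" for z
      using infdist_le[OF that, of c] by (simp add: d_def dist_norm norm_minus_commute)
    \<comment> \<open>With both poles within \<open>d / 4\<close> of \<open>c\<close>, the ratio of
      the series has modulus at most \<open>(d / 2) / (3 / 4 * d) = 2 / 3\<close>.\<close>
    have "poly_approximable K (\<lambda>z. 1 / (z - y))"
      if xy: "x \<in> E \<inter> ball c (d / 4)" "y \<in> E \<inter> ball c (d / 4)"
        and x: "poly_approximable K (\<lambda>z. 1 / (z - x))" for x y
    proof -
      have xc: "cmod (x - c) < d / 4" "cmod (y - c) < d / 4"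
        using xy by (auto simp: dist_norm norm_minus_commute)
      have yx: "cmod (y - x) \<le> d / 2"
        using norm_triangle_ineq4[of "y - c" "x - c"] xc by simp
      have zx: "cmod (z - x) \<ge> 3 / 4 * d" "cmod (z - y) \<ge> 3 / 4 * d" if "z \<in> K" for z
        using norm_triangle_ineq2[of "z - c" "x - c"] norm_triangle_ineq2[of "z - c" "y - c"]
          xc dz[OF that] by simp_all
      have "poly_approximable K (\<lambda>z. (y - x) * (1 / (z - x)))"
        by (intro poly_approximable_mult K poly_approximable_const x)
      then have "poly_approximable K (\<lambda>z. 1 / (1 - (y - x) * (1 / (z - x))))"
      proof (rule poly_approximable_geometric[OF K, of _ "2 / 3"])
        fix z assume z: "z \<in> K"
        have "cmod (y - x) / cmod (z - x) \<le> (d / 2) / (3 / 4 * d)"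
          using zx[OF z] yx d by (intro frac_le) auto
        then show "cmod ((y - x) * (1 / (z - x))) \<le> 2 / 3"
          using d by (simp add: norm_divide)
      qed simp
      then have "poly_approximable K (\<lambda>z. 1 / (z - x) * (1 / (1 - (y - x) * (1 / (z - x)))))"
        by (intro poly_approximable_mult K x)
      then show ?thesis
      proof (rule poly_approximable_cong)
        fix z assume z: "z \<in> K"
        have "z \<noteq> x" "z \<noteq> y" using zx[OF z] d by auto
        then show "1 / (z - x) * (1 / (1 - (y - x) * (1 / (z - x)))) = 1 / (z - y)"
          by (simp add: divide_simps)
      qed
    qed
    moreover have "openin (top_of_set E) (E \<inter> ball c (d / 4))" "c \<in> E \<inter> ball c (d / 4)"
      using c d by (auto simp: openin_open_Int)
    ultimately show "\<exists>T. openin (top_of_set E) T \<and> c \<in> T \<and>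
        (\<forall>x\<in>T. \<forall>y\<in>T. poly_approximable K (\<lambda>z. 1 / (z - x)) \<longrightarrow>
           poly_approximable K (\<lambda>z. 1 / (z - y)))"
      by blast
  qed
qed (simp add: poly_approximable_def)

text \<open>Over the complex numbers \<open>p\<close> splits into linear factors, so simple poles at
  its roots suffice; a multiple root just repeats a factor.\<close>

lemma poly_approximable_inverse_poly:
  assumes K: "compact K" and "p \<noteq> 0"
    and "\<And>a. poly p a = 0 \<Longrightarrow> poly_approximable K (\<lambda>z. 1 / (z - a))"
  shows "poly_approximable K (\<lambda>z. 1 / poly p z)"
  using assms(2,3)
proof (induction "degree p" arbitrary: p)
  case 0
  then obtain c where "p = [:c:]" using degree_eq_zeroE by metis
  then show ?case by (simp add: poly_approximable_const)
next
  case (Suc n)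
  obtain a where a: "poly p a = 0"
    using fundamental_theorem_of_algebra_alt[of p] Suc.hyps(2) by force
  then obtain q where q: "p = [:- a, 1:] * q" unfolding poly_eq_0_iff_dvd by (auto elim: dvdE)
  have q0: "q \<noteq> 0" using q Suc.prems by auto
  have "degree p = Suc (degree q)" unfolding q using q0 by (subst degree_mult_eq) auto
  then have "poly_approximable K (\<lambda>z. 1 / poly q z)"
    using Suc.hyps q0 Suc.prems(2) q by (intro Suc.hyps(1)) auto
  then have "poly_approximable K (\<lambda>z. 1 / (z - a) * (1 / poly q z))"
    by (intro poly_approximable_mult K Suc.prems(2) a)
  then show ?case by (rule poly_approximable_cong) (simp add: q algebra_simps)
qed

section \<open>Polynomial approximation on proper compact subsets of the circle\<close>

lemma poly_approximable_real_polynomial: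
  assumes K: "compact K" "K \<subseteq> sphere 0 1" and inv: "poly_approximable K (\<lambda>z. 1 / z)"
    and f: "real_polynomial_function f"
  shows "poly_approximable K (\<lambda>z. of_real (f z))"
  using f
proof induction
  case (linear f)
  \<comment> \<open>On the circle \<open>cnj z = 1 / z\<close>, so the real linear form
    \<open>Re z * f 1 + Im z * f \<i>\<close>, rewritten in \<open>z\<close> and
    \<open>cnj z\<close>, is \<open>\<alpha> * z + \<beta> * (1 / z)\<close>.\<close>
  define \<alpha> where "\<alpha> = (of_real (f 1) - \<i> * of_real (f \<i>)) / 2"
  define \<beta> where "\<beta> = (of_real (f 1) + \<i> * of_real (f \<i>)) / 2"
  have "poly_approximable K (\<lambda>z. \<alpha> * z + \<beta> * (1 / z))"
    by (intro poly_approximable_add poly_approximable_mult K poly_approximable_const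
        poly_approximable_id inv)
  then show ?case
  proof (rule poly_approximable_cong)
    fix z assume "z \<in> K"
    then have "cmod z = 1" using K(2) by auto
    then have inv_z: "1 / z = cnj z"
      by (simp add: divide_conv_cnj)
    have "z = Re z *\<^sub>R 1 + Im z *\<^sub>R \<i>" by (simp add: complex_eq_iff)
    then have "f z = f (Re z *\<^sub>R 1 + Im z *\<^sub>R \<i>)" by simp
    also have "\<dots> = Re z * f 1 + Im z * f \<i>"
      using linear by (simp add: bounded_linear.linear linear_add linear_scale)
    finally show "\<alpha> * z + \<beta> * (1 / z) = of_real (f z)"
      unfolding inv_z \<alpha>_def \<beta>_def by (simp add: complex_eq_iff field_simps)
  qed
next
  case (const c)
  show ?case by (rule poly_approximable_const)
next
  case (add f g)
  then show ?case by (simp add: poly_approximable_add)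
next
  case (mult f g)
  then show ?case by (simp add: poly_approximable_mult K)
qed

text \<open>This radial segment is the path on which poles leave the closed disc; by the conclusion
  it can meet the unit circle only at \<open>p\<close>, a point that the approximation sets
  omit.\<close>

lemma closed_segment_channel:
  assumes "cmod p = 1" "0 \<le> s" "z \<in> closed_segment (of_real s * p) (2 * p)" "s \<le> 2"
  obtains t where "z = of_real t * p" "s \<le> t" "cmod z = t"
proof -
  obtain u where u: "0 \<le> u" "u \<le> 1" "z = (1 - u) *\<^sub>R (of_real s * p) + u *\<^sub>R (2 * p)"
    using assms(3) by (auto simp: closed_segment_def)
  define t where "t = (1 - u) * s + u * 2"
  have zt: "z = of_real t * p" using u by (simp add: t_def scaleR_conv_of_real algebra_simps)
  have "t - s = u * (2 - s)" by (simp add: t_def algebra_simps)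
  also have "\<dots> \<ge> 0" using u assms by simp
  finally have st: "s \<le> t" by simp
  then have "cmod z = t" using zt assms by (simp add: norm_mult)
  then show ?thesis using that zt st by blast
qed

text \<open>The gap at \<open>p\<close> lets approximability pass from a pole outside the closed
  disc to the pole 0. Then \<open>1 / z\<close>, which is \<open>cnj z\<close> on \<open>K\<close>,
  is approximable, hence so are polynomials in the two real coordinates, and Stone-Weierstrass
  applies.\<close>

lemma poly_approximable_continuous:
  assumes K: "compact K" "K \<subseteq> sphere 0 1" and p: "cmod p = 1" "p \<notin> K"
    and f: "continuous_on K f"
  shows "poly_approximable K f"
proof (rule poly_approximable_closure)
  fix e :: real assume e: "e > 0"
  let ?E = "closed_segment (of_real 0 * p) (2 * p)"
  have "?E \<inter> K = {}"
  proof (rule ccontr)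
    assume "?E \<inter> K \<noteq> {}"
    then obtain z where z: "z \<in> ?E" "z \<in> K" by blast
    obtain t where "z = of_real t * p" "cmod z = t" using closed_segment_channel[OF p(1) _ z(1)] by auto
    then show False using z(2) K(2) p by auto
  qed
  then have "poly_approximable K (\<lambda>z. 1 / (z - 0))"
    by (rule poly_approximable_push_pole[OF K(1) connected_segment])
       (use K p in \<open>auto intro!: poly_approximable_far_pole[where q = 1]
          simp: norm_mult\<close>)
  then have inv: "poly_approximable K (\<lambda>z. 1 / z)" by simp
  obtain g where g: "polynomial_function g" "\<And>z. z \<in> K \<Longrightarrow> cmod (f z - g z) < e"
    using Stone_Weierstrass_polynomial_function[OF K(1) f e] by blast
  have "real_polynomial_function (Re \<circ> g)" "real_polynomial_function (Im \<circ> g)"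
    using g(1) bounded_linear_Re bounded_linear_Im by (auto simp: polynomial_function_def)
  then have "poly_approximable K (\<lambda>z. of_real ((Re \<circ> g) z) + \<i> * of_real ((Im \<circ> g) z))"
    by (intro poly_approximable_add poly_approximable_mult poly_approximable_const K
        poly_approximable_real_polynomial inv)
  then have "poly_approximable K g"
    by (rule poly_approximable_cong) (simp add: complex_eq[symmetric])
  then show "\<exists>g. poly_approximable K g \<and> (\<forall>z\<in>K. cmod (f z - g z) < e)" using g(2) by blast
qed

text \<open>A concrete case of Runge's theorem: as \<open>L\<close> omits \<open>p\<close>, the
  complement of \<open>cball 0 s \<union> L\<close> is connected, and the function equal to 0 on the
  disc and 1 on \<open>L\<close> is a uniform limit of polynomials.\<close>

lemma poly_separating:
  assumes L: "compact L" "L \<subseteq> sphere 0 1" and p: "cmod p = 1" "p \<notin> L"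
    and s: "0 < s" "s < 1" and e: "e > 0"
  obtains h where "\<And>z. cmod z \<le> s \<Longrightarrow> cmod (poly h z) < e"
    "\<And>z. z \<in> L \<Longrightarrow> cmod (poly h z - 1) < e"
proof -
  define \<sigma> where "\<sigma> = (s + 1) / 2"
  have \<sigma>: "s < \<sigma>" "\<sigma> < 1" "0 < \<sigma>" using s by (auto simp: \<sigma>_def)
  define K where "K = cball 0 s \<union> L"
  have K: "compact K" using L by (simp add: K_def compact_Un)
  have K1: "cmod z \<le> 1" if "z \<in> K" for z using that L s by (auto simp: K_def)
  \<comment> \<open>The circle lies strictly between the small disc and the unit circle; the segment
    leads from it through the gap at \<open>p\<close> to a point outside the closed unit
    disc.\<close>
  define E where "E = sphere 0 \<sigma> \<union> closed_segment (of_real \<sigma> * p) (2 * p)"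
  have "of_real \<sigma> * p \<in> sphere 0 \<sigma> \<inter> closed_segment (of_real \<sigma> * p) (2 * p)"
    using p \<sigma> by (simp add: norm_mult)
  then have E: "connected E"
    unfolding E_def by (intro connected_Un connected_sphere connected_segment) auto
  have EK: "E \<inter> K = {}"
  proof (rule ccontr)
    assume "E \<inter> K \<noteq> {}"
    then obtain z where z: "z \<in> E" "z \<in> K" by blast
    show False
    proof (cases "z \<in> sphere 0 \<sigma>")
      case True
      then show False using z(2) \<sigma> L by (auto simp: K_def)
    next
      case False
      then have "z \<in> closed_segment (of_real \<sigma> * p) (2 * p)" using z by (simp add: E_def)
      then obtain t where "z = of_real t * p" "\<sigma> \<le> t" "cmod z = t"
        using closed_segment_channel[OF p(1)] \<sigma> by (metis less_eq_real_def less_trans one_less_numeral_iff semiring_norm(76))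
      then show False using z(2) \<sigma> L p by (auto simp: K_def)
    qed
  qed
  have pole: "poly_approximable K (\<lambda>z. 1 / (z - a))" if "cmod a = \<sigma>" for a
    by (rule poly_approximable_push_pole[OF K E EK, of "2 * p"])
       (use that p K1 in \<open>auto simp: E_def norm_mult intro!: poly_approximable_far_pole[OF K, of 1]\<close>)
  \<comment> \<open>A common ratio for both estimates: the modulus of \<open>z / \<sigma>\<close> is
    at most \<open>s / \<sigma>\<close> on the disc, and that of \<open>\<sigma> / z\<close> is
    \<open>\<sigma>\<close> on \<open>L\<close>.\<close>
  define q where "q = max (s / \<sigma>) \<sigma>"
  have q: "0 < q" "q < 1" using s \<sigma> by (auto simp: q_def)
  \<comment> \<open>The bound 1/2 keeps \<open>1 - x\<close> and \<open>x - 1\<close> at modulus at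
    least 1/2; dividing by them at most doubles \<open>e / 4\<close>, and the other half of
    \<open>e\<close> is left for the approximation by \<open>k\<close>.\<close>
  define \<delta> where "\<delta> = min (1 / 2) (e / 4)"
  have \<delta>: "0 < \<delta>" "\<delta> \<le> 1 / 2" "\<delta> \<le> e / 4" using e by (auto simp: \<delta>_def)
  obtain n where n: "q ^ n < \<delta>" using real_arch_pow_inv[OF \<delta>(1) q(2)] by blast
  have n0: "n > 0" using n \<delta> by (intro gr0I) auto
  \<comment> \<open>\<open>1 / P\<close> tends to 1 on \<open>|z| < \<sigma>\<close> and to 0 on \<open>|z| > \<sigma>\<close>; its poles on \<open>|z| = \<sigma>\<close> can be pushed out
     along \<open>E\<close>, which leaves the closed disc at \<open>p\<close>.\<close>
  define P :: "complex poly" where "P = [:1:] - monom (of_real (1 / \<sigma> ^ n)) n"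
  have P: "poly P z = 1 - (z / of_real \<sigma>) ^ n" for z
    by (simp add: P_def poly_monom power_divide)
  have "poly P 0 = 1" using n0 by (simp add: P)
  then have "P \<noteq> 0" by auto
  moreover have "poly_approximable K (\<lambda>z. 1 / (z - a))" if "poly P a = 0" for a
  proof (rule pole)
    have "(a / of_real \<sigma>) ^ n = 1" using that P by simp
    then have "cmod (a / of_real \<sigma>) ^ n = 1" by (metis norm_one norm_power)
    then have "cmod (a / of_real \<sigma>) = 1"
      using n0 power_eq_imp_eq_base[of "cmod (a / of_real \<sigma>)" n 1] by simp
    then show "cmod a = \<sigma>" using \<sigma> by (simp add: norm_divide)
  qed
  ultimately have "poly_approximable K (\<lambda>z. 1 / poly P z)"
    by (intro poly_approximable_inverse_poly K) auto
  then obtain k where k: "\<And>z. z \<in> K \<Longrightarrow> cmod (1 / poly P z - poly k z) < e / 2"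
    using e unfolding poly_approximable_def by (meson half_gt_zero)
  show ?thesis
  \<comment> \<open>\<open>k\<close> is near 1 on the disc and near 0 on \<open>L\<close>, so its
    difference from 1 has the required values.\<close>
  proof (rule that[of "[:1:] - k"])
    fix z assume z: "cmod z \<le> s"
    define x where "x = (z / of_real \<sigma>) ^ n"
    have "cmod x \<le> q ^ n"
      using z \<sigma> by (auto simp: x_def norm_power norm_divide q_def divide_right_mono le_max_iff_disj intro!: power_mono)
    then have x: "cmod x < \<delta>" using n by simp
    have x1: "cmod (1 - x) \<ge> 1 / 2" using x \<delta> norm_triangle_ineq2[of 1 x] by simp
    then have "x \<noteq> 1" by auto
    moreover have "poly P z = 1 - x" by (simp only: P x_def)
    ultimately have "1 - 1 / poly P z = - x / (1 - x)" by (simp add: divide_simps)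
    then have "cmod (1 - 1 / poly P z) = cmod x / cmod (1 - x)" by (simp add: norm_divide)
    also have "\<dots> \<le> \<delta> / (1 / 2)" using x x1 \<delta> by (intro frac_le) auto
    also have "\<dots> \<le> e / 2" using \<delta> by simp
    finally have "cmod (1 - 1 / poly P z) \<le> e / 2" .
    moreover have "cmod (1 / poly P z - poly k z) < e / 2" using k z by (simp add: K_def)
    ultimately show "cmod (poly ([:1:] - k) z) < e"
      using norm_triangle_ineq[of "1 - 1 / poly P z" "1 / poly P z - poly k z"] by simp
  next
    fix z assume z: "z \<in> L"
    define x where "x = (of_real \<sigma> / z) ^ n"
    have z1: "cmod z = 1" using z L by auto
    have "cmod x \<le> q ^ n"
      using z1 \<sigma> by (auto simp: x_def norm_power norm_divide q_def le_max_iff_disj intro!: power_mono)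
    then have x: "cmod x < \<delta>" using n by simp
    have x1: "cmod (x - 1) \<ge> 1 / 2"
      using x \<delta> norm_triangle_ineq2[of 1 x] by (simp add: norm_minus_commute)
    have x0: "x \<noteq> 0" using z1 \<sigma> by (auto simp: x_def)
    have "(z / of_real \<sigma>) ^ n = 1 / x" by (simp add: x_def power_divide)
    then have "poly P z = (x - 1) / x" using x0 by (simp add: P diff_divide_distrib)
    then have "1 / poly P z = x / (x - 1)" by simp
    then have "cmod (1 / poly P z) = cmod x / cmod (x - 1)" by (simp add: norm_divide)
    also have "\<dots> \<le> \<delta> / (1 / 2)" using x x1 \<delta> by (intro frac_le) auto
    also have "\<dots> \<le> e / 2" using \<delta> by simp
    finally have "cmod (1 / poly P z) \<le> e / 2" .
    moreover have "cmod (1 / poly P z - poly k z) < e / 2" using k z by (simp add: K_def)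
    ultimately show "cmod (poly ([:1:] - k) z - 1) < e"
      using norm_triangle_ineq4[of "1 / poly P z - poly k z" "1 / poly P z"]
      by (simp add: norm_minus_commute)
  qed
qed

subsection \<open>Baire category in the space of holomorphic functions\<close>

lemma compact_subset_ball_cball:
  fixes S :: "complex set"
  assumes S: "compact S" "S \<subseteq> ball 0 1"
  obtains s where "0 < s" "s < 1" "S \<subseteq> cball 0 s"
proof (cases "S = {}")
  case False
  obtain w where w: "w \<in> S" "\<And>z. z \<in> S \<Longrightarrow> cmod z \<le> cmod w"
    using continuous_attains_sup[OF S(1) False, of cmod] continuous_on_norm_id by blast
  show ?thesis
  proof (rule that[of "max (1 / 2) (cmod w)"])
    show "S \<subseteq> cball 0 (max (1 / 2) (cmod w))" using w(2) by (auto simp: le_max_iff_disj)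
  qed (use w(1) S(2) in auto)
qed (use that[of "1 / 2"] in auto)

text \<open>Weierstrass' theorem; restricting the limit gives the extensional representative that
  \<open>hol_disc\<close> demands.\<close>

lemma hol_disc_uniform_limit:
  assumes g: "\<And>n. g n \<in> hol_disc"
    and lim: "\<And>K. compact K \<Longrightarrow> K \<subseteq> ball 0 1 \<Longrightarrow> uniform_limit K g F sequentially"
  shows "restrict F (ball 0 1) \<in> hol_disc"
proof -
  have "F holomorphic_on ball 0 1"
  proof (rule holomorphic_uniform_sequence[of _ g])
    show "\<exists>d>0. cball x d \<subseteq> ball 0 1 \<and> uniform_limit (cball x d) g F sequentially"
      if "x \<in> ball 0 1" for x :: complex
      using lim that by (metis compact_cball open_ball open_contains_cball)
  qed (use g in \<open>auto simp: hol_disc_def\<close>)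
  then have "restrict F (ball 0 1) holomorphic_on ball 0 1"
    by (rule holomorphic_transform) simp
  then show ?thesis by (simp add: hol_disc_def)
qed

lemma hol_nbhd_mono: "L \<subseteq> K \<Longrightarrow> d \<le> e \<Longrightarrow> hol_nbhd f K d \<subseteq> hol_nbhd f L e"
  by (force simp: hol_nbhd_def)

text \<open>One step of Baire's argument. Enlarging the compact set and reducing the radius only
  shrinks a basic neighbourhood, so \<open>L\<close> and \<open>d\<close> can be prescribed.\<close>

lemma hol_top_dense_step:
  assumes G: "openin hol_top G" "hol_top closure_of G = hol_disc"
    and U: "openin hol_top U" "U \<noteq> {}"
    and L: "compact L" "L \<subseteq> ball 0 1" and d: "d > 0"
  obtains g K e where "g \<in> hol_disc" "compact K" "K \<subseteq> ball 0 1" "L \<subseteq> K" "0 < e" "e \<le> d"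
    "hol_nbhd g K e \<subseteq> G \<inter> U"
proof -
  have "G \<inter> U \<noteq> {}"
    using G(2) U dense_intersects_open[of hol_top G] by auto
  then obtain g where g: "g \<in> G \<inter> U" by blast
  have GU: "openin hol_top (G \<inter> U)" using G(1) U(1) by blast
  then obtain K e where K: "compact K" "K \<subseteq> ball 0 1" "e > 0" "hol_nbhd g K e \<subseteq> G \<inter> U"
    using g unfolding openin_hol_top by blast
  show ?thesis
  proof (rule that[of g "K \<union> L" "min e d"])
    show "g \<in> hol_disc" using g GU by (auto simp: openin_hol_top)
    show "hol_nbhd g (K \<union> L) (min e d) \<subseteq> G \<inter> U"
      using hol_nbhd_mono[of K "K \<union> L" "min e d" e g] K(4) by auto
  qed (use K L d in auto)
qed

text \<open>The nested-ball proof for complete metric spaces, run directly with compact sets and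
  radii: the centres of nested basic neighbourhoods converge locally uniformly, and the limit lies
  in every \<open>G n\<close> and in \<open>T\<close>.\<close>

lemma hol_top_Baire:
  assumes G: "\<And>n::nat. openin hol_top (G n)" "\<And>n. hol_top closure_of (G n) = hol_disc"
  shows "hol_top closure_of (\<Inter>n. G n) = hol_disc"
proof -
  have "(\<Inter>n. G n) \<inter> T \<noteq> {}" if T: "openin hol_top T" "T \<noteq> {}" for T
  proof -
    \<comment> \<open>An exhaustion of the disc, starting with the single point 0. Requiring
      \<open>C n \<subseteq> K\<close> below makes the estimates reach every compact subset.\<close>
    define C :: "nat \<Rightarrow> complex set" where "C n = cball 0 (1 - 1 / Suc n)" for n
    have C: "compact (C n)" "C n \<subseteq> ball 0 1" for n
    proof -
      have "1 - 1 / real (Suc n) < 1" by simp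
      then show "compact (C n)" "C n \<subseteq> ball 0 1"
        by (simp_all add: C_def cball_subset_ball_iff del: of_nat_Suc)
    qed
    have C_mono: "C m \<subseteq> C n" if "m \<le> n" for m n
      unfolding C_def by (intro subset_cball) (use that in \<open>simp add: frac_le\<close>)
    define P where "P n x = (case x of (g, K, e) \<Rightarrow> g \<in> hol_disc \<and> compact K \<and> K \<subseteq> ball 0 1 \<and>
        C n \<subseteq> K \<and> 0 < e \<and> e \<le> (1 / 2) ^ n \<and> hol_nbhd g K e \<subseteq> G n \<inter> T)"
      for n and x :: "(complex \<Rightarrow> complex) \<times> complex set \<times> real"
    \<comment> \<open>Halving the radius leaves room: the distance to the limit is bounded by
      \<open>e / 2\<close> only non-strictly, while membership in a neighbourhood of radius
      \<open>e\<close> is strict.\<close>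
    define Q where "Q x y = (case x of (g, K, e) \<Rightarrow> case y of (g', K', e') \<Rightarrow>
        hol_nbhd g' K' e' \<subseteq> hol_nbhd g K (e / 2))"
      for x y :: "(complex \<Rightarrow> complex) \<times> complex set \<times> real"
    have "\<exists>X. \<forall>n. P n (X n) \<and> Q (X n) (X (Suc n))"
    proof (rule dependent_nat_choice)
      show "\<exists>x. P 0 x"
        using hol_top_dense_step[OF G T C(1,2)[of 0], of "(1 / 2) ^ 0"]
        unfolding P_def split_paired_Ex prod.case by (metis zero_less_power half_gt_zero zero_less_one)
    next
      fix x n assume x: "P n x"
      obtain g K e where x_eq: "x = (g, K, e)" by (cases x)
      have x': "g \<in> hol_disc" "compact K" "K \<subseteq> ball 0 1" "0 < e" "hol_nbhd g K e \<subseteq> T"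
        using x by (auto simp: P_def x_eq)
      have U: "openin hol_top (hol_nbhd g K (e / 2))" by (intro openin_hol_nbhd x')
      have "g \<in> hol_nbhd g K (e / 2)" using x' by (simp add: hol_nbhd_refl)
      then have "hol_nbhd g K (e / 2) \<noteq> {}" by blast
      then obtain g' K' e' where y: "g' \<in> hol_disc" "compact K'" "K' \<subseteq> ball 0 1" "C (Suc n) \<subseteq> K'"
        "0 < e'" "e' \<le> (1 / 2) ^ Suc n" "hol_nbhd g' K' e' \<subseteq> G (Suc n) \<inter> hol_nbhd g K (e / 2)"
        by (rule hol_top_dense_step[where d = "(1 / 2) ^ Suc n", OF G U _ C]) auto
      moreover have "hol_nbhd g K (e / 2) \<subseteq> hol_nbhd g K e"
        using x'(4) by (intro hol_nbhd_mono) auto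
      ultimately have "P (Suc n) (g', K', e')" "Q x (g', K', e')"
        using x'(5) by (auto simp: P_def Q_def x_eq)
      then show "\<exists>y. P (Suc n) y \<and> Q x y" by blast
    qed
    then obtain X where X: "\<And>n. P n (X n)" "\<And>n. Q (X n) (X (Suc n))" by blast
    define g K e where "g n = fst (X n)" and "K n = fst (snd (X n))" and "e n = snd (snd (X n))" for n
    have X_eq: "X n = (g n, K n, e n)" for n by (simp add: g_def K_def e_def)
    have g: "g n \<in> hol_disc" and K: "compact (K n)" "K n \<subseteq> ball 0 1" "C n \<subseteq> K n"
      and e: "0 < e n" "e n \<le> (1 / 2) ^ n" and sub: "hol_nbhd (g n) (K n) (e n) \<subseteq> G n \<inter> T" for n
      using X(1)[of n] by (auto simp: P_def X_eq)
    have nest: "hol_nbhd (g (Suc n)) (K (Suc n)) (e (Suc n)) \<subseteq> hol_nbhd (g n) (K n) (e n / 2)" for n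
      using X(2)[of n] by (simp add: Q_def X_eq)
    have "hol_nbhd (g (Suc n)) (K (Suc n)) (e (Suc n)) \<subseteq> hol_nbhd (g n) (K n) (e n)" for n
      using nest[of n] hol_nbhd_mono[of "K n" "K n" "e n / 2" "e n" "g n"] e(1)[of n] by auto
    then have dec: "hol_nbhd (g m) (K m) (e m) \<subseteq> hol_nbhd (g n) (K n) (e n)" if "n \<le> m" for m n
      using lift_Suc_antimono_le[of "\<lambda>n. hol_nbhd (g n) (K n) (e n)"] that by blast
    have close: "dist (g m z) (g n z) \<le> e n / 2" if "n \<le> m" "z \<in> K n" for m n z
    proof (cases "m = n")
      case False
      then have "g m \<in> hol_nbhd (g n) (K n) (e n / 2)"
        using dec[of "Suc n" m] nest[of n] hol_nbhd_refl[OF g e(1), of m "K m"] that(1) by auto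
      then show ?thesis using that(2) by (auto simp: hol_nbhd_def)
    qed (use e in \<open>simp add: less_imp_le\<close>)
    define F where "F z = lim (\<lambda>n. g n z)" for z
    have in_C: "\<exists>n. z \<in> C n" if "z \<in> ball 0 1" for z
    proof -
      have "0 < 1 - cmod z" using that by simp
      then obtain n where "inverse (real (Suc n)) < 1 - cmod z" using reals_Archimedean by blast
      then show ?thesis by (intro exI[of _ n]) (simp add: C_def inverse_eq_divide)
    qed
    have small: "\<exists>N. \<forall>n\<ge>N. e n < \<epsilon>" if "\<epsilon> > 0" for \<epsilon>
    proof -
      obtain N where N: "(1 / 2) ^ N < \<epsilon>" using real_arch_pow_inv[of \<epsilon> "1 / 2"] \<open>\<epsilon> > 0\<close> by auto
      have "e n < \<epsilon>" if "n \<ge> N" for n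
      proof -
        have "(1 / 2 :: real) ^ n \<le> (1 / 2) ^ N" using that by (intro power_decreasing) auto
        then show ?thesis using e(2)[of n] N by linarith
      qed
      then show ?thesis by blast
    qed
    have F: "(\<lambda>n. g n z) \<longlonglongrightarrow> F z" if z: "z \<in> ball 0 1" for z
    proof -
      obtain n0 where n0: "z \<in> C n0" using in_C z by blast
      have "Cauchy (\<lambda>n. g n z)"
        unfolding Cauchy_altdef2
      proof (intro allI impI)
        fix \<epsilon> :: real assume "\<epsilon> > 0"
        then obtain N where N: "\<And>n. n \<ge> N \<Longrightarrow> e n < \<epsilon>" using small by blast
        have "dist (g m z) (g (max N n0) z) < \<epsilon>" if "m \<ge> max N n0" for m
        proof -
          have "z \<in> K (max N n0)" using n0 C_mono[of n0 "max N n0"] K(3)[of "max N n0"] by auto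
          then show ?thesis
            using close[OF that, of z] N[of "max N n0"] e(1)[of "max N n0"] by simp
        qed
        then show "\<exists>N. \<forall>n\<ge>N. dist (g n z) (g N z) < \<epsilon>" by blast
      qed
      then show ?thesis
        unfolding F_def using Cauchy_convergent convergent_LIMSEQ_iff by blast
    qed
    have F_close: "dist (g n z) (F z) \<le> e n / 2" if "z \<in> K n" for z n
    proof (rule Lim_dist_ubound)
      show "(\<lambda>m. g m z) \<longlonglongrightarrow> F z" using F K(2) that by blast
      show "\<forall>\<^sub>F m in sequentially. dist (g n z) (g m z) \<le> e n / 2"
        using close[of n _ z] that by (auto simp: eventually_sequentially dist_commute)
    qed simp
    have "uniform_limit S g F sequentially" if S: "compact S" "S \<subseteq> ball 0 1" for S
      unfolding uniform_limit_iff eventually_sequentially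
    proof (intro allI impI)
      fix \<epsilon> :: real assume "\<epsilon> > 0"
      then obtain N where N: "\<And>n. n \<ge> N \<Longrightarrow> e n < \<epsilon>" using small by blast
      have "\<exists>n0. S \<subseteq> C n0"
      proof -
        obtain s where s: "s < 1" "S \<subseteq> cball 0 s"
          using compact_subset_ball_cball[OF S] by blast
        obtain n0 where "inverse (real (Suc n0)) < 1 - s"
          using reals_Archimedean[of "1 - s"] s by auto
        then have "cball 0 s \<subseteq> C n0" by (auto simp: C_def inverse_eq_divide)
        then show ?thesis using s by blast
      qed
      then obtain n0 where n0: "S \<subseteq> C n0" by blast
      have "dist (g n z) (F z) < \<epsilon>" if "n \<ge> max N n0" "z \<in> S" for n z
      proof -
        have "z \<in> K n" using n0 C_mono[of n0 n] K(3)[of n] that by auto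
        then show ?thesis using F_close[of z n] N[of n] that e(1)[of n] by simp
      qed
      then show "\<exists>N. \<forall>n\<ge>N. \<forall>z\<in>S. dist (g n z) (F z) < \<epsilon>" by blast
    qed
    then have F_hol: "restrict F (ball 0 1) \<in> hol_disc"
      by (rule hol_disc_uniform_limit[OF g])
    have "restrict F (ball 0 1) \<in> hol_nbhd (g n) (K n) (e n)" for n
      unfolding hol_nbhd_def
    proof (intro CollectI conjI ballI F_hol)
      fix z assume z: "z \<in> K n"
      then have "z \<in> ball 0 1" using K(2) by blast
      then show "dist (restrict F (ball 0 1) z) (g n z) < e n"
        using F_close[OF z] e(1)[of n] by (simp add: dist_commute)
    qed
    then have "restrict F (ball 0 1) \<in> (\<Inter>n. G n) \<inter> T" using sub by blast
    then show ?thesis by blast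
  qed
  then show ?thesis
    using dense_intersects_open[of hol_top "\<Inter>n. G n"] by auto
qed

text \<open>Enumerating the countable family, possibly with repetitions, yields the sequence to
  which Baire's theorem applies.\<close>

lemma residual_in_hol_top_Inter:
  assumes "countable \<G>" "\<G> \<noteq> {}"
    and "\<And>G. G \<in> \<G> \<Longrightarrow> openin hol_top G" "\<And>G. G \<in> \<G> \<Longrightarrow> hol_top closure_of G = hol_disc"
  shows "residual_in hol_top (\<Inter>\<G>)"
proof -
  have "\<Inter>\<G> = (\<Inter>n. from_nat_into \<G> n)"
    using assms(1,2) by (metis range_from_nat_into)
  moreover have "hol_top closure_of (\<Inter>n. from_nat_into \<G> n) = hol_disc"
    by (intro hol_top_Baire assms from_nat_into)
  ultimately have "hol_top closure_of (\<Inter>\<G>) = hol_disc" by simp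
  moreover have "gdelta_in hol_top (\<Inter>\<G>)"
    using assms by (intro gdelta_in_Inter open_imp_gdelta_in) auto
  ultimately show ?thesis
    using gdelta_in_subset[of hol_top "\<Inter>\<G>"] by (auto simp only: residual_in_def topspace_hol_top)
qed

subsection \<open>Automorphisms of the disc\<close>

text \<open>For \<open>cmod \<alpha> = 1\<close> and \<open>cmod a < 1\<close> this is the general
  Moebius automorphism of the disc: a rotation after the Blaschke factor with zero
  \<open>a\<close>.\<close>

definition disc_moebius :: "complex \<Rightarrow> complex \<Rightarrow> complex \<Rightarrow> complex" where
  "disc_moebius \<alpha> a z = \<alpha> * (z - a) / (1 - cnj a * z)"

lemma disc_moebius_denominator:
  assumes "cmod a < 1" "cmod z \<le> 1"
  shows "1 - cmod a \<le> cmod (1 - cnj a * z)" "1 - cnj a * z \<noteq> 0"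
proof -
  have "cmod (cnj a * z) \<le> cmod a"
    using assms mult_left_le[of "cmod z" "cmod a"] by (simp add: norm_mult)
  then show le: "1 - cmod a \<le> cmod (1 - cnj a * z)"
    using norm_triangle_ineq2[of 1 "cnj a * z"] by simp
  show "1 - cnj a * z \<noteq> 0" using le assms(1) by auto
qed

text \<open>After clearing denominators this is a polynomial identity. Its right side is positive
  inside the disc and 0 on the circle, so both sets are preserved.\<close>

lemma disc_moebius_norm:
  assumes "cmod \<alpha> = 1" "cmod a < 1" "cmod z \<le> 1"
  shows "1 - (cmod (disc_moebius \<alpha> a z))\<^sup>2 =
    (1 - (cmod a)\<^sup>2) * (1 - (cmod z)\<^sup>2) / (cmod (1 - cnj a * z))\<^sup>2"
proof -
  have "(cmod (1 - cnj a * z))\<^sup>2 - (cmod (z - a))\<^sup>2 = (1 - (cmod a)\<^sup>2) * (1 - (cmod z)\<^sup>2)"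
    by (simp only: cmod_power2) (simp add: power2_eq_square algebra_simps)
  moreover have "cmod (1 - cnj a * z) \<noteq> 0" using disc_moebius_denominator[OF assms(2,3)] by simp
  moreover have "cmod (disc_moebius \<alpha> a z) = cmod (z - a) / cmod (1 - cnj a * z)"
    using assms(1) by (simp add: disc_moebius_def norm_mult norm_divide)
  ultimately show ?thesis
    by (simp add: power_divide diff_divide_eq_iff)
qed

lemma disc_moebius_norm_less:
  assumes "cmod \<alpha> = 1" "cmod a < 1" "cmod z < 1"
  shows "cmod (disc_moebius \<alpha> a z) < 1"
proof -
  have "0 < 1 - (cmod (disc_moebius \<alpha> a z))\<^sup>2"
    using disc_moebius_denominator[of a z] assms by (subst disc_moebius_norm) (auto simp: power_less_one_iff)
  then show ?thesis by (simp add: power_less_one_iff)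
qed

lemma disc_moebius_norm_one:
  assumes "cmod \<alpha> = 1" "cmod a < 1" "cmod z = 1"
  shows "cmod (disc_moebius \<alpha> a z) = 1"
proof -
  have "(cmod (disc_moebius \<alpha> a z))\<^sup>2 = 1\<^sup>2" using disc_moebius_norm[of \<alpha> a z] assms by simp
  then show ?thesis by (rule power2_eq_imp_eq) simp_all
qed

text \<open>The inverse belongs to the same family. At \<open>disc_moebius \<alpha> a z\<close> its
  numerator and denominator share the factor \<open>(1 - cnj a * a) / (1 - cnj a * z)\<close>, whose
  cancellation leaves \<open>z\<close>.\<close>

lemma disc_moebius_inverse:
  assumes "cmod \<alpha> = 1" "cmod a < 1" "cmod z \<le> 1"
  shows "disc_moebius (cnj \<alpha>) (- \<alpha> * a) (disc_moebius \<alpha> a z) = z"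
proof -
  let ?d = "1 - cnj a * z"
  have d: "?d \<noteq> 0" using disc_moebius_denominator assms by blast
  have \<alpha>: "cnj \<alpha> * \<alpha> = 1" using assms(1) by (metis complex_norm_square mult.commute of_real_1 one_power2)
  have a: "1 - cnj a * a \<noteq> 0" using disc_moebius_denominator[of a a] assms(2) by simp
  have "cnj \<alpha> * (\<alpha> * (z - a) / ?d + \<alpha> * a) = (cnj \<alpha> * \<alpha>) * ((z - a) / ?d + a)"
    by (simp add: algebra_simps)
  also have "\<dots> = z * (1 - cnj a * a) / ?d"
    using d by (simp add: \<alpha> divide_simps) (simp add: algebra_simps)
  finally have num: "cnj \<alpha> * (\<alpha> * (z - a) / ?d + \<alpha> * a) = z * (1 - cnj a * a) / ?d" .
  have "1 + cnj (\<alpha> * a) * (\<alpha> * (z - a) / ?d) = 1 + (cnj \<alpha> * \<alpha>) * (cnj a * (z - a) / ?d)"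
    by (simp add: algebra_simps)
  also have "\<dots> = (1 - cnj a * a) / ?d"
    using d by (simp add: \<alpha> divide_simps) (simp add: algebra_simps)
  finally have den: "1 + cnj (\<alpha> * a) * (\<alpha> * (z - a) / ?d) = (1 - cnj a * a) / ?d" .
  show ?thesis
    using num den d a by (simp add: disc_moebius_def)
qed

text \<open>The difference of two values is explicit, with denominator of modulus at least
  \<open>(1 - cmod a)\<^sup>2\<close>. The constant depends on \<open>cmod a\<close> alone, which
  the inverse map shares.\<close>

lemma disc_moebius_lipschitz:
  assumes "cmod \<alpha> = 1" "cmod a < 1"
  shows "(1 / (1 - cmod a)\<^sup>2)-lipschitz_on (cball 0 1) (disc_moebius \<alpha> a)"
proof (rule lipschitz_onI)
  fix z w :: complex assume "z \<in> cball 0 1" "w \<in> cball 0 1"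
  then have z: "cmod z \<le> 1" and w: "cmod w \<le> 1" by auto
  note dz = disc_moebius_denominator[OF assms(2) z] and dw = disc_moebius_denominator[OF assms(2) w]
  have "disc_moebius \<alpha> a z - disc_moebius \<alpha> a w =
      \<alpha> * (z - w) * (1 - cnj a * a) / ((1 - cnj a * z) * (1 - cnj a * w))"
    using dz(2) dw(2) by (simp add: disc_moebius_def divide_simps) (simp add: algebra_simps)
  then have "dist (disc_moebius \<alpha> a z) (disc_moebius \<alpha> a w) =
      cmod (z - w) * cmod (1 - cnj a * a) / (cmod (1 - cnj a * z) * cmod (1 - cnj a * w))"
    using assms(1) by (simp add: dist_norm norm_mult norm_divide)
  also have "\<dots> \<le> cmod (z - w) * 1 / ((1 - cmod a) * (1 - cmod a))"
  proof (intro frac_le mult_left_mono mult_mono dz(1) dw(1))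
    have "cmod a ^ 2 \<le> 1" using assms(2) by (simp add: power_le_one)
    moreover have "1 - cnj a * a = of_real (1 - cmod a ^ 2)"
      using complex_norm_square[of a] by (simp add: mult.commute)
    ultimately show "cmod (1 - cnj a * a) \<le> 1" by (simp only: norm_of_real) simp
  qed (use assms in auto)
  finally show "dist (disc_moebius \<alpha> a z) (disc_moebius \<alpha> a w) \<le> 1 / (1 - cmod a)\<^sup>2 * dist z w"
    by (simp add: dist_norm power2_eq_square)
qed simp

lemma disc_moebius_holomorphic:
  assumes "cmod a < 1"
  shows "disc_moebius \<alpha> a holomorphic_on ball 0 1"
  unfolding disc_moebius_def
  by (intro holomorphic_intros) (use disc_moebius_denominator(2)[OF assms] in \<open>simp add: less_imp_le\<close>)

text \<open>Normalise by the Moebius map sending \<open>\<Phi> 0\<close> to 0. Schwarz's lemma for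
  the resulting \<open>g\<close> and for its inverse \<open>k\<close> gives
  \<open>cmod (g z) = cmod z\<close> at one nonzero point, and the equality case makes
  \<open>g\<close> a rotation.\<close>

lemma disc_automorphism_moebius:
  assumes "disc_automorphism \<Phi>"
  obtains \<alpha> a where "cmod \<alpha> = 1" "cmod a < 1" "\<And>z. cmod z < 1 \<Longrightarrow> \<Phi> z = disc_moebius \<alpha> a z"
proof -
  have hol: "\<Phi> holomorphic_on ball 0 1" and bij: "bij_betw \<Phi> (ball 0 1) (ball 0 1)"
    using assms by (auto simp: disc_automorphism_def)
  have im: "\<Phi> ` ball 0 1 = ball 0 1" and inj: "inj_on \<Phi> (ball 0 1)"
    using bij by (auto simp: bij_betw_def)
  obtain \<Psi> where \<Psi>: "\<Psi> holomorphic_on ball 0 1" "\<And>z. z \<in> ball 0 1 \<Longrightarrow> \<Psi> (\<Phi> z) = z"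
    using holomorphic_has_inverse[OF hol open_ball inj] unfolding im by metis
  have \<Phi>1: "cmod (\<Phi> z) < 1" if "cmod z < 1" for z using im that by auto
  have \<Psi>1: "cmod (\<Psi> z) < 1" if "cmod z < 1" for z
  proof -
    have "z \<in> \<Phi> ` ball 0 1" using that im by simp
    then show ?thesis using \<Psi>(2) by auto
  qed
  define b where "b = \<Phi> 0"
  have b: "cmod b < 1" "cmod (- b) < 1" using \<Phi>1[of 0] by (auto simp: b_def)
  define g where "g = disc_moebius 1 b \<circ> \<Phi>"
  define k where "k = \<Psi> \<circ> disc_moebius 1 (- b)"
  have g_hol: "g holomorphic_on ball 0 1"
    unfolding g_def by (rule holomorphic_on_compose_gen[OF hol disc_moebius_holomorphic[OF b(1)]])
      (use \<Phi>1 in auto)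
  have k_hol: "k holomorphic_on ball 0 1"
    unfolding k_def by (rule holomorphic_on_compose_gen[OF disc_moebius_holomorphic[OF b(2)] \<Psi>(1)])
      (use disc_moebius_norm_less[of 1 "- b"] b in auto)
  have g1: "cmod (g z) < 1" if "cmod z < 1" for z
    using disc_moebius_norm_less[of 1 b] \<Phi>1[OF that] b by (simp add: g_def)
  have k1: "cmod (k z) < 1" if "cmod z < 1" for z
    using disc_moebius_norm_less[of 1 "- b" z] \<Psi>1 b that by (simp add: k_def)
  have g0: "g 0 = 0" by (simp add: g_def b_def disc_moebius_def)
  have k0: "k 0 = 0" using \<Psi>(2)[of 0] by (simp add: k_def b_def disc_moebius_def)
  have inv: "disc_moebius 1 (- b) (g z) = \<Phi> z" if "cmod z < 1" for z
    using disc_moebius_inverse[of 1 b "\<Phi> z"] b \<Phi>1[OF that] by (simp add: g_def)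
  have half: "cmod (1 / 2 :: complex) < 1" by (simp add: norm_divide)
  have "k (g (1 / 2)) = 1 / 2"
    using inv[OF half] \<Psi>(2)[of "1 / 2"] half by (simp add: k_def)
  then have "cmod (1 / 2 :: complex) \<le> cmod (g (1 / 2))"
    using Schwarz_Lemma(1)[OF k_hol k0 k1 g1[OF half]] by metis
  moreover have "cmod (g (1 / 2)) \<le> cmod (1 / 2 :: complex)"
    by (rule Schwarz_Lemma(1)[OF g_hol g0 g1 half])
  ultimately have "cmod (g (1 / 2)) = cmod (1 / 2 :: complex)" by simp
  then obtain \<alpha> where \<alpha>: "\<And>z. cmod z < 1 \<Longrightarrow> g z = \<alpha> * z" "cmod \<alpha> = 1"
    using Schwarz_Lemma(3)[OF g_hol g0 g1 half] half by fastforce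
  have \<alpha>': "\<alpha> * cnj \<alpha> = 1" using \<alpha>(2) by (metis complex_norm_square of_real_1 one_power2)
  show ?thesis
  \<comment> \<open>Pulling \<open>\<alpha>\<close> out of the numerator of
    \<open>(\<alpha> * z + b) / (1 + cnj b * \<alpha> * z)\<close> exhibits the zero
    \<open>- cnj \<alpha> * b\<close>.\<close>
  proof (rule that[of \<alpha> "- cnj \<alpha> * b"])
    fix z :: complex assume z: "cmod z < 1"
    have "\<alpha> * (z + cnj \<alpha> * b) = \<alpha> * z + (\<alpha> * cnj \<alpha>) * b" by (simp add: algebra_simps)
    then show "\<Phi> z = disc_moebius \<alpha> (- cnj \<alpha> * b) z"
      using inv[OF z] \<alpha>(1)[OF z] \<alpha>' by (simp add: disc_moebius_def mult_ac)
  qed (use \<alpha> b in \<open>auto simp: norm_mult\<close>)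
qed

text \<open>\<open>\<Phi>\<close> is known only on the open disc, so boundary values come from the
  Moebius formula \<open>M\<close>. One constant \<open>B\<close> serves both directions because the
  inverse has a parameter of the same modulus.\<close>

lemma disc_automorphism_extension:
  assumes "disc_automorphism \<Phi>"
  obtains M M' B where "\<And>z. z \<in> ball 0 1 \<Longrightarrow> M z = \<Phi> z"
    "M ` ball 0 1 \<subseteq> ball 0 1" "M ` sphere 0 1 \<subseteq> sphere 0 1" "M' ` sphere 0 1 \<subseteq> sphere 0 1"
    "\<And>z. z \<in> cball 0 1 \<Longrightarrow> M' (M z) = z"
    "B-lipschitz_on (cball 0 1) M" "B-lipschitz_on (cball 0 1) M'"
proof -
  obtain \<alpha> a where a: "cmod \<alpha> = 1" "cmod a < 1" "\<And>z. cmod z < 1 \<Longrightarrow> \<Phi> z = disc_moebius \<alpha> a z"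
    using disc_automorphism_moebius[OF assms] by blast
  have b: "cmod (cnj \<alpha>) = 1" "cmod (- \<alpha> * a) < 1" "cmod (- \<alpha> * a) = cmod a"
    using a by (auto simp: norm_mult)
  show ?thesis
  proof (rule that[of "disc_moebius \<alpha> a" "disc_moebius (cnj \<alpha>) (- \<alpha> * a)" "1 / (1 - cmod a)\<^sup>2"])
    show "(1 / (1 - cmod a)\<^sup>2)-lipschitz_on (cball 0 1) (disc_moebius (cnj \<alpha>) (- \<alpha> * a))"
      using disc_moebius_lipschitz[OF b(1,2)] unfolding b(3) .
  qed (use a b disc_moebius_norm_less disc_moebius_norm_one disc_moebius_inverse disc_moebius_lipschitz in auto)
qed

subsection \<open>Approximation on cut annuli\<close>

text \<open>Coefficients are taken from a countable dense set. In Horner's scheme, multiplication by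
  \<open>z\<close> does not increase an error on the closed disc, so each coefficient may spend half
  of the remaining tolerance.\<close>

lemma countable_dense_polys:
  obtains \<Q> :: "complex poly set" where "countable \<Q>"
    "\<And>p e. e > 0 \<Longrightarrow> \<exists>q\<in>\<Q>. \<forall>z\<in>cball 0 1. cmod (poly p z - poly q z) < e"
proof -
  obtain D :: "complex set" where D: "countable D" "\<And>X. open X \<Longrightarrow> X \<noteq> {} \<Longrightarrow> \<exists>d\<in>D. d \<in> X"
    using countable_dense_setE by blast
  have "\<exists>q\<in>Poly ` lists D. \<forall>z\<in>cball 0 1. cmod (poly p z - poly q z) < e" if "e > 0" for p e
    using that
  proof (induction p arbitrary: e)
    case 0
    have "0 \<in> Poly ` lists D" by (metis Poly.simps(1) image_eqI lists.Nil)
    then show ?case using 0 by force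
  next
    case (pCons a p)
    then have e: "e / 2 > 0" by simp
    obtain d where d: "d \<in> D" "cmod (a - d) < e / 2"
      using D(2)[of "ball a (e / 2)"] e by (auto simp: dist_norm)
    obtain q where q: "q \<in> Poly ` lists D" "\<And>z. z \<in> cball 0 1 \<Longrightarrow> cmod (poly p z - poly q z) < e / 2"
      using pCons.IH[OF e] by blast
    have "cmod (poly (pCons a p) z - poly (pCons d q) z) < e" if z: "z \<in> cball 0 1" for z
    proof -
      have "cmod (z * (poly p z - poly q z)) \<le> cmod (poly p z - poly q z)"
        using z by (simp add: norm_mult mult_left_le_one_le)
      also have "\<dots> < e / 2" by (rule q(2)[OF z])
      finally have "cmod ((a - d) + z * (poly p z - poly q z)) < e"
        using norm_add_less[OF d(2)] by fastforce
      then show ?thesis by (simp add: algebra_simps)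
    qed
    moreover have "pCons d q \<in> Poly ` lists D"
      using q(1) d(1) by (metis (no_types, lifting) Poly.simps(2) image_iff lists.Cons)
    ultimately show ?case by blast
  qed
  then show ?thesis using that[of "Poly ` lists D"] D(1) by auto
qed

text \<open>The dilate \<open>f (t * z)\<close> with \<open>t < 1\<close> near 1 is continuous up to
  the circle, and uniform continuity of \<open>f\<close> on \<open>cball 0 s\<close> keeps it close
  to \<open>f\<close> there.\<close>

lemma holomorphic_dilate:
  assumes f: "f holomorphic_on ball 0 1" and s: "s < 1" and e: "e > 0"
  obtains g where "g holomorphic_on ball 0 1" "continuous_on (cball 0 1) g"
    "\<And>z. cmod z \<le> s \<Longrightarrow> cmod (g z - f z) < e"
proof -
  have "continuous_on (cball 0 s) f"
    by (rule continuous_on_subset[OF holomorphic_on_imp_continuous_on[OF f]])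
       (use s in \<open>simp add: cball_subset_ball_iff\<close>)
  then have "uniformly_continuous_on (cball 0 s) f"
    by (rule compact_uniformly_continuous) simp
  then obtain d where d: "d > 0"
    "\<And>z w. z \<in> cball 0 s \<Longrightarrow> w \<in> cball 0 s \<Longrightarrow> dist w z < d \<Longrightarrow> dist (f w) (f z) < e"
    using e unfolding uniformly_continuous_on_def by metis
  \<comment> \<open>\<open>1 - t \<le> d / 2\<close> moves points by less than \<open>d\<close>; the
    value 1/2 keeps \<open>t\<close> positive when \<open>d\<close> is large.\<close>
  define t where "t = max (1 / 2) (1 - d / 2)"
  have t: "0 < t" "t < 1" "1 - t < d" using d(1) by (auto simp: t_def)
  have tz: "cmod (of_real t * z) = t * cmod z" for z using t by (simp add: norm_mult)
  have t1: "of_real t * z \<in> ball 0 1" if "cmod z \<le> 1" for z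
    using mult_left_le[OF that, of t] t unfolding mem_ball_0 tz by linarith
  show ?thesis
  proof (rule that[of "f \<circ> (\<lambda>z. of_real t * z)"])
    show "f \<circ> (\<lambda>z. of_real t * z) holomorphic_on ball 0 1"
      by (rule holomorphic_on_compose_gen[OF _ f]) (use t1 in \<open>auto intro!: holomorphic_intros\<close>)
    show "continuous_on (cball 0 1) (f \<circ> (\<lambda>z. of_real t * z))"
      by (intro continuous_on_compose continuous_intros
          continuous_on_subset[OF holomorphic_on_imp_continuous_on[OF f]]) (use t1 in auto)
    show "cmod ((f \<circ> (\<lambda>z. of_real t * z)) z - f z) < e" if z: "cmod z \<le> s" for z
    proof -
      have "z - of_real t * z = of_real (1 - t) * z" by (simp add: algebra_simps)
      then have "dist (of_real t * z) z = (1 - t) * cmod z"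
        using t by (metis abs_of_pos diff_gt_0_iff_gt dist_commute dist_norm norm_mult norm_of_real)
      also have "\<dots> \<le> 1 - t" using t z s by (intro mult_left_le) auto
      finally have "dist (of_real t * z) z < d" using t by simp
      moreover have "cmod (of_real t * z) \<le> s"
        using z t mult_left_le_one_le[of "cmod z" t] by (simp add: tz)
      ultimately show ?thesis using d(2)[of z "of_real t * z"] z by (simp add: dist_norm)
    qed
  qed
qed

lemma norm_sgn_diff:
  assumes "z \<noteq> 0"
  shows "cmod (sgn z - z) = \<bar>1 - cmod z\<bar>"
proof -
  have "of_real (cmod z) * sgn z = z" using assms by (simp add: sgn_eq)
  then have "sgn z - z = of_real (1 - cmod z) * sgn z"
    by (metis left_diff_distrib mult_1 of_real_1 of_real_diff)
  then show ?thesis using assms by (simp only: norm_mult norm_of_real norm_sgn) simp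
qed

text \<open>Here \<open>\<rho>\<close> is the radius \<open>r\<^sub>n\<close> and \<open>c\<close> bounds the Lipschitz constants of an automorphism and of its
  inverse.  The part near \<open>p\<close> is removed because a full annulus separates the disc from infinity, which
  would make polynomial approximation impossible.\<close>

definition cut_annulus :: "real \<Rightarrow> real \<Rightarrow> complex \<Rightarrow> real \<Rightarrow> complex set" where
  "cut_annulus \<rho> c p \<delta> =
     {z. 1 - c * (1 - \<rho>) \<le> cmod z \<and> cmod z \<le> 1 - (1 - \<rho>) / c \<and> \<delta> \<le> cmod (z - p)}"

lemma compact_cut_annulus: "compact (cut_annulus \<rho> c p \<delta>)"
proof -
  have "cut_annulus \<rho> c p \<delta> = cball 0 (1 - (1 - \<rho>) / c) \<inter>
      ({z. 1 - c * (1 - \<rho>) \<le> cmod z} \<inter> {z. \<delta> \<le> cmod (z - p)})"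
    by (auto simp: cut_annulus_def)
  moreover have "closed ({z. 1 - c * (1 - \<rho>) \<le> cmod z} \<inter> {z. \<delta> \<le> cmod (z - p)})"
    by (intro closed_Int closed_Collect_le continuous_intros)
  ultimately show ?thesis by (simp add: compact_Int_closed)
qed

lemma cut_annulus_subset_ball:
  assumes "c > 0" "\<rho> < 1"
  shows "cut_annulus \<rho> c p \<delta> \<subseteq> ball 0 1"
proof -
  have "(1 - \<rho>) / c > 0" using assms by simp
  then show ?thesis by (auto simp: cut_annulus_def)
qed

text \<open>Intersecting over all \<open>N\<close> yields approximation for arbitrarily large
  \<open>n\<close>.\<close>

definition approx_on_cut_annulus ::
    "(nat \<Rightarrow> real) \<Rightarrow> complex poly \<Rightarrow> real \<Rightarrow> complex \<Rightarrow> real \<Rightarrow> nat \<Rightarrow> real \<Rightarrow> (complex \<Rightarrow> complex) set" where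
  "approx_on_cut_annulus r q c p \<delta> N e =
     {f \<in> hol_disc. \<exists>n\<ge>N. \<forall>z\<in>cut_annulus (r n) c p \<delta>. cmod (f z - poly q z) < e}"

text \<open>A union over \<open>n\<close> of basic neighbourhoods of \<open>q\<close>, as each cut
  annulus is a compact subset of the open disc.\<close>

lemma openin_approx_on_cut_annulus:
  assumes r: "\<And>n. r n < 1" and c: "c > 0"
  shows "openin hol_top (approx_on_cut_annulus r q c p \<delta> N e)"
proof -
  let ?q = "restrict (poly q) (ball 0 1)"
  have "?q holomorphic_on ball 0 1"
    by (rule holomorphic_transform[of "poly q"]) (auto intro: holomorphic_intros)
  then have q: "?q \<in> hol_disc" by (simp add: hol_disc_def)
  have sub: "cut_annulus (r n) c p \<delta> \<subseteq> ball 0 1" for n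
    by (intro cut_annulus_subset_ball r c)
  have "approx_on_cut_annulus r q c p \<delta> N e = (\<Union>n\<in>{N..}. hol_nbhd ?q (cut_annulus (r n) c p \<delta>) e)"
    using sub by (fastforce simp: approx_on_cut_annulus_def hol_nbhd_def dist_norm)
  also have "openin hol_top \<dots>"
    by (intro openin_Union) (auto intro!: openin_hol_nbhd q compact_cut_annulus sub)
  finally show ?thesis .
qed

lemma dense_approx_on_cut_annulus:
  assumes r: "\<And>n. r n < 1" "r \<longlonglongrightarrow> 1" and c: "c > 0" and p: "cmod p = 1"
    and \<delta>: "\<delta> > 0" and e: "e > 0"
  shows "hol_top closure_of (approx_on_cut_annulus r q c p \<delta> N e) = hol_disc"
proof -
  have "approx_on_cut_annulus r q c p \<delta> N e \<inter> T \<noteq> {}" if T: "openin hol_top T" "T \<noteq> {}" for T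
  proof -
    obtain f K \<epsilon> where f: "f \<in> T" and K: "compact K" "K \<subseteq> ball 0 1" and \<epsilon>: "\<epsilon> > 0"
      and sub: "hol_nbhd f K \<epsilon> \<subseteq> T"
      using T unfolding openin_hol_top by blast
    have f_hol: "f holomorphic_on ball 0 1"
      using f openin_subset[OF T(1)] by (auto simp: hol_disc_def)
    obtain s where s: "0 < s" "s < 1" "K \<subseteq> cball 0 s"
      using compact_subset_ball_cball[OF K] by blast
    have "\<epsilon> / 2 > 0" using \<epsilon> by simp
    then obtain g where g: "g holomorphic_on ball 0 1" "continuous_on (cball 0 1) g"
      "\<And>z. cmod z \<le> s \<Longrightarrow> cmod (g z - f z) < \<epsilon> / 2"
      using holomorphic_dilate[OF f_hol s(2)] by metis
    \<comment> \<open>This bound up to the circle is the reason for passing from \<open>f\<close> to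
      its dilate \<open>g\<close>.\<close>
    have "bounded ((\<lambda>z. poly q z - g z) ` cball 0 1)"
      by (intro compact_imp_bounded compact_continuous_image continuous_intros g(2)) auto
    then obtain M where M: "M > 0" "\<And>z. cmod z \<le> 1 \<Longrightarrow> cmod (poly q z - g z) \<le> M"
      unfolding bounded_pos by auto
    \<comment> \<open>The error is at most \<open>\<kappa> * M\<close> from \<open>g\<close> on the
      small disc and below \<open>2 * \<kappa> * M\<close> from \<open>q\<close> on the cut
      annulus.\<close>
    define \<kappa> where "\<kappa> = min (\<epsilon> / 2) (e / 2) / M"
    have \<kappa>: "\<kappa> > 0" "\<kappa> * M \<le> \<epsilon> / 2" "2 * \<kappa> * M \<le> e" using \<epsilon> e M by (auto simp: \<kappa>_def)
    \<comment> \<open>Half of \<open>\<delta>\<close> is given up to the radial projection of the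
      cut annulus to the circle, which thus lands in \<open>L\<close>.\<close>
    define L where "L = {z \<in> sphere 0 1. \<delta> / 2 \<le> cmod (z - p)}"
    have "L = sphere 0 1 \<inter> {z. \<delta> / 2 \<le> cmod (z - p)}" by (auto simp: L_def)
    moreover have "closed {z. \<delta> / 2 \<le> cmod (z - p)}"
      by (intro closed_Collect_le continuous_intros)
    ultimately have L: "compact L" "L \<subseteq> sphere 0 1" "p \<notin> L"
      using \<delta> by (auto simp: compact_Int_closed)
    obtain h where h: "\<And>z. cmod z \<le> s \<Longrightarrow> cmod (poly h z) < \<kappa>"
      "\<And>z. z \<in> L \<Longrightarrow> cmod (poly h z - 1) < \<kappa>"
      using poly_separating[OF L(1,2) p L(3) s(1,2) \<kappa>(1)] by blast
    have "uniformly_continuous_on (cball 0 1) (poly h)"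
      by (intro compact_uniformly_continuous continuous_intros) simp
    then obtain \<eta> where \<eta>: "\<eta> > 0" "\<And>z w. cmod z \<le> 1 \<Longrightarrow> cmod w \<le> 1 \<Longrightarrow> cmod (w - z) < \<eta>
        \<Longrightarrow> cmod (poly h w - poly h z) < \<kappa>"
      using \<kappa>(1) unfolding uniformly_continuous_on_def by (metis dist_norm mem_cball_0)
    \<comment> \<open>Points of modulus above \<open>1 - b\<close> are nonzero, are within
      \<open>\<eta>\<close> of their radial projection, and move by at most
      \<open>\<delta> / 2\<close> under it.\<close>
    define b where "b = min 1 (min \<eta> (\<delta> / 2))"
    have b: "b > 0" "b \<le> 1" "b \<le> \<eta>" "b \<le> \<delta> / 2" using \<eta> \<delta> by (auto simp: b_def)
    have "(\<lambda>n. c * (1 - r n)) \<longlonglongrightarrow> c * (1 - 1)" by (intro tendsto_intros r)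
    then have "\<forall>\<^sub>F n in sequentially. c * (1 - r n) < b" by (rule order_tendstoD) (use b in simp)
    then obtain n where n: "n \<ge> N" "c * (1 - r n) < b"
      unfolding eventually_sequentially by (metis nle_le)
    define F where "F = restrict (\<lambda>z. g z + poly h z * (poly q z - g z)) (ball 0 1)"
    have "F holomorphic_on ball 0 1"
      unfolding F_def
      by (rule holomorphic_transform[of "\<lambda>z. g z + poly h z * (poly q z - g z)"])
         (auto intro!: holomorphic_intros g)
    then have F: "F \<in> hol_disc" by (simp add: hol_disc_def F_def)
    have "cmod (F z - f z) < \<epsilon>" if z: "cmod z \<le> s" for z
    proof -
      have F_eq: "F z - f z = (g z - f z) + poly h z * (poly q z - g z)"
        using z s by (simp add: F_def)
      have "cmod (poly h z * (poly q z - g z)) \<le> \<kappa> * M"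
        unfolding norm_mult using h(1)[OF z] M(2)[of z] z s \<kappa> by (intro mult_mono) auto
      then show ?thesis
        unfolding F_eq
        using norm_triangle_ineq[of "g z - f z" "poly h z * (poly q z - g z)"] g(3)[OF z] \<kappa>(2)
        by linarith
    qed
    then have "F \<in> hol_nbhd f K \<epsilon>"
      using F s(3) by (auto simp: hol_nbhd_def dist_norm)
    moreover have "cmod (F z - poly q z) < e" if z: "z \<in> cut_annulus (r n) c p \<delta>" for z
    proof -
      have z1: "cmod z < 1" using z cut_annulus_subset_ball[OF c r(1)] by fastforce
      have zb: "1 - cmod z < b" and zp: "\<delta> \<le> cmod (z - p)"
        using z n(2) by (auto simp: cut_annulus_def)
      have z0: "z \<noteq> 0" using zb b by auto
      define w where "w = sgn z"
      have w: "cmod w = 1" using z0 by (simp add: w_def norm_sgn)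
      have wz: "cmod (w - z) = 1 - cmod z"
        using z0 z1 by (simp add: w_def norm_sgn_diff)
      have "\<delta> / 2 \<le> cmod (w - p)"
        using norm_triangle_ineq[of "z - w" "w - p"] wz zb b zp by (simp add: norm_minus_commute)
      then have "w \<in> L" using w by (simp add: L_def)
      then have "cmod (poly h z - 1) < 2 * \<kappa>"
        using norm_triangle_ineq[of "poly h z - poly h w" "poly h w - 1"] h(2)[of w]
          \<eta>(2)[of w z] w z1 wz zb b by (simp add: norm_minus_commute)
      \<comment> \<open>The construction gives \<open>F - q = (h - 1) * (q - g)\<close>.\<close>
      moreover have "cmod (F z - poly q z) = cmod (poly h z - 1) * cmod (poly q z - g z)"
        using z1 by (simp add: F_def algebra_simps flip: norm_mult)
      moreover have "cmod (poly q z - g z) \<le> M" using M(2) z1 by simp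
      ultimately have "cmod (F z - poly q z) \<le> cmod (poly h z - 1) * M"
          and "cmod (poly h z - 1) * M < 2 * \<kappa> * M"
        using M(1) by (simp_all add: mult_left_mono)
      then show ?thesis using \<kappa>(3) by linarith
    qed
    then have "F \<in> approx_on_cut_annulus r q c p \<delta> N e"
      using F n(1) by (auto simp: approx_on_cut_annulus_def)
    ultimately show ?thesis using sub by blast
  qed
  then show ?thesis
    using dense_intersects_open[of hol_top "approx_on_cut_annulus r q c p \<delta> N e"] by auto
qed

section \<open>From the open conditions to universality along automorphisms\<close>

lemma UA_discI:
  assumes f: "f \<in> hol_disc"
    and approx: "\<And>K \<phi> e N. compact K \<Longrightarrow> K \<subseteq> sphere 0 1 \<Longrightarrow> K \<noteq> sphere 0 1 \<Longrightarrow>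
      continuous_on K \<phi> \<Longrightarrow> e > 0 \<Longrightarrow> \<exists>n\<ge>N. \<forall>\<zeta>\<in>K. cmod (f (of_real (r n) * \<zeta>) - \<phi> \<zeta>) < e"
  shows "f \<in> UA_disc r"
proof -
  have "\<exists>n. strict_mono n \<and> uniform_limit K (\<lambda>k \<zeta>. f (of_real (r (n k)) * \<zeta>)) \<phi> sequentially"
    if K: "compact K" "K \<subseteq> sphere 0 1" "K \<noteq> sphere 0 1" "continuous_on K \<phi>" for K \<phi>
  proof -
    \<comment> \<open>A single good index beyond every \<open>N\<close> suffices: dependent choice
      with tolerances \<open>1 / (k + 1)\<close> builds the increasing sequence.\<close>
    let ?P = "\<lambda>k n. \<forall>\<zeta>\<in>K. cmod (f (of_real (r n) * \<zeta>) - \<phi> \<zeta>) < inverse (Suc k)"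
    have "\<exists>n. \<forall>k. ?P k (n k) \<and> n k < n (Suc k)"
    proof (rule dependent_nat_choice)
      show "\<exists>n. ?P 0 n" using approx[OF K, of "inverse (Suc 0)" 0] by auto
      show "\<exists>m. ?P (Suc k) m \<and> n < m" for k n
        using approx[OF K, of "inverse (Suc (Suc k))" "Suc n"] by (auto simp: Suc_le_eq)
    qed
    then obtain n where n: "\<And>k. ?P k (n k)" "\<And>k. n k < n (Suc k)" by blast
    have "uniform_limit K (\<lambda>k \<zeta>. f (of_real (r (n k)) * \<zeta>)) \<phi> sequentially"
      unfolding uniform_limit_iff
    proof (intro allI impI)
      fix e :: real assume "e > 0"
      then have "\<forall>\<^sub>F k in sequentially. inverse (real (Suc k)) < e"
        using order_tendstoD(2)[OF LIMSEQ_inverse_real_of_nat] by blast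
      then show "\<forall>\<^sub>F k in sequentially. \<forall>\<zeta>\<in>K. dist (f (of_real (r (n k)) * \<zeta>)) (\<phi> \<zeta>) < e"
      proof eventually_elim
        case (elim k)
        show ?case using n(1)[of k] elim by (metis dist_norm less_trans)
      qed
    qed
    moreover have "strict_mono n" using n(2) by (simp add: strict_mono_Suc_iff)
    ultimately show ?thesis by blast
  qed
  then show ?thesis using f by (auto simp: UA_disc_def)
qed

text \<open>Normalising a countable dense subset of the plane supplies countably many cut points
  \<open>p\<close>, dense on the circle, because \<open>sgn\<close> is continuous away from
  0.\<close>

lemma dense_directions:
  fixes D :: "complex set"
  assumes D: "\<And>X. open X \<Longrightarrow> X \<noteq> {} \<Longrightarrow> \<exists>d\<in>D. d \<in> X"
    and L: "closed L" "u \<notin> L" "cmod u = 1"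
  obtains d where "d \<in> D" "d \<noteq> 0" "sgn d \<notin> L"
proof -
  have "open (- {0} \<inter> sgn -` (- L))"
    by (intro continuous_open_preimage continuous_intros) (use L in auto)
  moreover have "u \<in> - {0} \<inter> sgn -` (- L)" using L by (auto simp: sgn_eq)
  ultimately show ?thesis using D that by blast
qed

text \<open>The Lipschitz bound for \<open>M\<close> keeps the image near \<open>M \<zeta>\<close>,
  which bounds its modulus from below and its distance from \<open>p\<close>. The bound for the
  inverse \<open>M'\<close> prevents it from coming too close to the circle.\<close>

lemma disc_automorphism_hits_cut_annulus:
  assumes M: "M ` sphere 0 1 \<subseteq> sphere 0 1" "M' ` sphere 0 1 \<subseteq> sphere 0 1" "M ` ball 0 1 \<subseteq> ball 0 1"
    and inv: "\<And>z. z \<in> cball 0 1 \<Longrightarrow> M' (M z) = z"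
    and B: "B-lipschitz_on (cball 0 1) M" "B-lipschitz_on (cball 0 1) M'" "B \<le> c" "c > 0"
    and \<zeta>: "cmod \<zeta> = 1" and \<rho>: "0 \<le> \<rho>" "\<rho> < 1"
    and p: "\<delta> + c * (1 - \<rho>) \<le> cmod (M \<zeta> - p)"
  shows "M (of_real \<rho> * \<zeta>) \<in> cut_annulus \<rho> c p \<delta>"
    and "cmod (M (of_real \<rho> * \<zeta>) - M \<zeta>) \<le> c * (1 - \<rho>)"
proof -
  define x where "x = of_real \<rho> * \<zeta>"
  have x: "cmod x = \<rho>" using \<zeta> \<rho> by (simp add: x_def norm_mult)
  have "x - \<zeta> = of_real (\<rho> - 1) * \<zeta>" by (simp add: x_def algebra_simps)
  then have x\<zeta>: "cmod (x - \<zeta>) = 1 - \<rho>" using \<zeta> \<rho> by (simp only: norm_mult norm_of_real) simp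
  have Mx: "cmod (M x) < 1" and M\<zeta>: "cmod (M \<zeta>) = 1" using M x \<zeta> \<rho> by fastforce+
  have "cmod (M x - M \<zeta>) \<le> B * (1 - \<rho>)"
    using lipschitz_onD[OF B(1), of x \<zeta>] x \<zeta> \<rho> x\<zeta> by (simp add: dist_norm)
  also have "\<dots> \<le> c * (1 - \<rho>)" using B(3) \<rho> by (intro mult_right_mono) auto
  finally show near: "cmod (M (of_real \<rho> * \<zeta>) - M \<zeta>) \<le> c * (1 - \<rho>)" by (simp add: x_def)
  \<comment> \<open>\<open>w\<close> is a point of the circle nearest to \<open>M x\<close>; at
    \<open>M x = 0\<close>, where \<open>sgn\<close> vanishes, any point of the circle will
    do.\<close>
  obtain w where w: "cmod w = 1" "cmod (w - M x) = 1 - cmod (M x)"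
  proof (cases "M x = 0")
    case False
    then have "cmod (sgn (M x) - M x) = 1 - cmod (M x)"
      using Mx by (simp add: norm_sgn_diff)
    then show ?thesis using that[of "sgn (M x)"] False by (simp add: norm_sgn)
  qed (use that[of 1] in auto)
  \<comment> \<open>\<open>M' w\<close> lies on the circle while \<open>M' (M x) = x\<close> has
    modulus \<open>\<rho>\<close>.\<close>
  have "1 - \<rho> \<le> cmod (M' w - M' (M x))"
    using norm_triangle_ineq2[of "M' w" x] M(2) w(1) inv[of x] x \<rho> by (simp add: image_subset_iff)
  also have "\<dots> \<le> B * (1 - cmod (M x))"
    using lipschitz_onD[OF B(2), of w "M x"] w Mx by (simp add: dist_norm)
  also have "\<dots> \<le> c * (1 - cmod (M x))" using B(3) Mx by (intro mult_right_mono) auto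
  finally have "cmod (M x) \<le> 1 - (1 - \<rho>) / c" using B(4) by (simp add: field_simps)
  moreover have "1 - c * (1 - \<rho>) \<le> cmod (M x)"
    using norm_triangle_ineq2[of "M \<zeta>" "M x"] near M\<zeta> by (simp add: x_def norm_minus_commute)
  moreover have "\<delta> \<le> cmod (M x - p)"
    using norm_triangle_ineq[of "M \<zeta> - M x" "M x - p"] near p by (simp add: x_def norm_minus_commute)
  ultimately show "M (of_real \<rho> * \<zeta>) \<in> cut_annulus \<rho> c p \<delta>" by (simp add: cut_annulus_def x_def)
qed

theorem theorem5p1:
  fixes r :: "nat \<Rightarrow> real"
  assumes "incseq r"
    and "\<And>n. r n \<in> {0..<1}"
    and "r \<longlonglongrightarrow> 1"
  shows "\<exists>S. residual_in hol_top S \<and>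
           (\<forall>f\<in>S. \<forall>\<Phi>. disc_automorphism \<Phi> \<longrightarrow> compose (ball 0 1) f \<Phi> \<in> UA_disc r)"
proof -
  have r: "0 \<le> r n" "r n < 1" for n using assms(2)[of n] by auto
  obtain \<Q> where \<Q>: "countable \<Q>"
    "\<And>p e. e > 0 \<Longrightarrow> \<exists>q\<in>\<Q>. \<forall>z\<in>cball 0 1. cmod (poly p z - poly q z) < e"
    using countable_dense_polys by blast
  obtain D :: "complex set" where D: "countable D" "\<And>X. open X \<Longrightarrow> X \<noteq> {} \<Longrightarrow> \<exists>d\<in>D. d \<in> X"
    using countable_dense_setE by blast
  \<comment> \<open>All real parameters are discretised: \<open>j + 1\<close> dominates the
    Lipschitz constant, \<open>sgn d\<close> is the cut point, \<open>1 / (m + 1)\<close> the size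
    of the cut and \<open>1 / (k + 1)\<close> the tolerance.\<close>
  define G where "G = (\<lambda>(q, j, d, m, N, k).
      approx_on_cut_annulus r q (real (Suc j)) (sgn d) (inverse (real (Suc m))) N (inverse (real (Suc k))))"
  \<comment> \<open>The index \<open>d = 0\<close> is left out because \<open>sgn 0 = 0\<close> is
    not on the circle.\<close>
  define I where "I = \<Q> \<times> (UNIV :: nat set) \<times> (D - {0}) \<times> (UNIV :: nat set) \<times> (UNIV :: nat set) \<times> (UNIV :: nat set)"
  have "residual_in hol_top (\<Inter>(G ` I))"
  proof (rule residual_in_hol_top_Inter)
    show "countable (G ` I)" using \<Q>(1) D(1) by (auto simp: I_def)
    have "\<Q> \<noteq> {}" using \<Q>(2)[of 1] by auto
    moreover have "D - {0} \<noteq> {}" using D(2)[of "ball 2 1"] by auto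
    ultimately show "G ` I \<noteq> {}" by (simp add: I_def)
    fix X assume "X \<in> G ` I"
    then obtain i where i: "i \<in> I" "X = G i" by blast
    obtain q j d m N k where i_eq: "i = (q, j, d, m, N, k)" by (cases i)
    have d: "d \<noteq> 0" and X: "X = approx_on_cut_annulus r q (real (Suc j)) (sgn d)
        (inverse (real (Suc m))) N (inverse (real (Suc k)))"
      using i by (simp_all add: i_eq I_def G_def)
    show "openin hol_top X"
      unfolding X by (intro openin_approx_on_cut_annulus r) simp
    show "hol_top closure_of X = hol_disc"
      unfolding X by (intro dense_approx_on_cut_annulus r assms(3)) (use d in \<open>simp_all add: norm_sgn\<close>)
  qed
  moreover have "compose (ball 0 1) f \<Phi> \<in> UA_disc r"
    if f: "f \<in> \<Inter>(G ` I)" and \<Phi>: "disc_automorphism \<Phi>" for f \<Phi>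
  proof (rule UA_discI)
    have f_hol: "f \<in> hol_disc"
      using calculation f by (auto simp: residual_in_def)
    have "f \<circ> \<Phi> holomorphic_on ball 0 1"
      using \<Phi> f_hol by (intro holomorphic_on_compose_gen[of \<Phi> _ f "ball 0 1"])
        (auto simp: disc_automorphism_def hol_disc_def bij_betw_def)
    then have "compose (ball 0 1) f \<Phi> holomorphic_on ball 0 1"
      by (rule holomorphic_transform) (simp add: compose_def)
    then show "compose (ball 0 1) f \<Phi> \<in> hol_disc" by (simp add: hol_disc_def)
    fix K :: "complex set" and \<phi> :: "complex \<Rightarrow> complex" and e :: real and N :: nat
    assume K: "compact K" "K \<subseteq> sphere 0 1" "K \<noteq> sphere 0 1" and \<phi>: "continuous_on K \<phi>"
      and e: "e > 0"
    obtain M M' B where M: "\<And>z. z \<in> ball 0 1 \<Longrightarrow> M z = \<Phi> z"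
      "M ` ball 0 1 \<subseteq> ball 0 1" "M ` sphere 0 1 \<subseteq> sphere 0 1" "M' ` sphere 0 1 \<subseteq> sphere 0 1"
      "\<And>z. z \<in> cball 0 1 \<Longrightarrow> M' (M z) = z"
      "B-lipschitz_on (cball 0 1) M" "B-lipschitz_on (cball 0 1) M'"
      using disc_automorphism_extension[OF \<Phi>] by blast
    have K_cball: "K \<subseteq> cball 0 1" using K(2) sphere_cball by blast
    have "continuous_on K M"
      by (rule continuous_on_subset[OF lipschitz_on_continuous_on[OF M(6)] K_cball])
    then have MK: "compact (M ` K)" "M ` K \<subseteq> sphere 0 1"
      using K M(3) by (auto intro: compact_continuous_image)
    have "(\<lambda>\<zeta>. M' (M \<zeta>)) ` K = (\<lambda>\<zeta>. \<zeta>) ` K"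
      by (intro image_cong refl M(5)) (use K_cball in blast)
    then have M'MK: "M' ` M ` K = K" by (simp add: image_image)
    have "continuous_on (M ` K) M'"
      by (rule continuous_on_subset[OF lipschitz_on_continuous_on[OF M(7)]
            subset_trans[OF MK(2) sphere_cball]])
    then have \<psi>: "continuous_on (M ` K) (\<lambda>w. \<phi> (M' w))"
      by (rule continuous_on_compose2[OF \<phi>]) (simp add: M'MK)
    obtain v where v: "v \<in> sphere 0 1" "v \<notin> K" using K by blast
    then have "v \<in> cball 0 1" by simp
    then have "M v \<notin> M ` K" using v(2) M(5) K_cball by (metis imageE subsetD)
    moreover have "cmod (M v) = 1" using M(3) v(1) by (simp add: image_subset_iff)
    ultimately obtain d where d: "d \<in> D" "d \<noteq> 0" "sgn d \<notin> M ` K"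
      using dense_directions[OF D(2)] MK(1) compact_imp_closed by metis
    define p where "p = sgn d"
    have p: "cmod p = 1" using d by (simp add: p_def norm_sgn)
    obtain \<delta> where \<delta>: "\<delta> > 0" "\<And>w. w \<in> M ` K \<Longrightarrow> \<delta> \<le> cmod (w - p)"
      using separate_point_closed[of "M ` K" p] MK(1) d(3) compact_imp_closed
      by (metis dist_norm norm_minus_commute p_def)
    \<comment> \<open>Half of \<open>\<delta>\<close> is for the cut and half for the displacement
      \<open>c * (1 - r n)\<close>. Likewise \<open>e\<close> is split into quarters:
      \<open>f\<close> against \<open>q\<close>, \<open>q\<close> between nearby points,
      \<open>q\<close> against \<open>q0\<close>, and \<open>q0\<close> against the target.\<close>
    obtain m where m: "inverse (real (Suc m)) < \<delta> / 2" using reals_Archimedean[of "\<delta> / 2"] \<delta>(1) by auto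
    obtain k where k: "inverse (real (Suc k)) < e / 4" using reals_Archimedean[of "e / 4"] e by auto
    obtain j where "B < real j" using reals_Archimedean2 by blast
    then have j: "B \<le> real (Suc j)" by simp
    define c where "c = real (Suc j)"
    have "poly_approximable (M ` K) (\<lambda>w. \<phi> (M' w))"
      by (rule poly_approximable_continuous[OF MK p _ \<psi>]) (use d in \<open>simp add: p_def\<close>)
    then obtain q0 where q0: "\<And>w. w \<in> M ` K \<Longrightarrow> cmod (\<phi> (M' w) - poly q0 w) < e / 4"
      using e unfolding poly_approximable_def by (meson zero_less_divide_iff zero_less_numeral)
    obtain q where q: "q \<in> \<Q>" "\<And>z. cmod z \<le> 1 \<Longrightarrow> cmod (poly q0 z - poly q z) < e / 4"
      using \<Q>(2)[of "e / 4" q0] e by auto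
    have "uniformly_continuous_on (cball 0 1) (poly q)"
      by (intro compact_uniformly_continuous continuous_intros) simp
    then obtain \<eta> where \<eta>: "\<eta> > 0" "\<And>z w. cmod z \<le> 1 \<Longrightarrow> cmod w \<le> 1 \<Longrightarrow> cmod (w - z) < \<eta>
        \<Longrightarrow> cmod (poly q w - poly q z) < e / 4"
      using e unfolding uniformly_continuous_on_def
      by (metis dist_norm mem_cball_0 zero_less_divide_iff zero_less_numeral)
    have "(\<lambda>n. c * (1 - r n)) \<longlonglongrightarrow> c * (1 - 1)" by (intro tendsto_intros assms(3))
    then have "\<forall>\<^sub>F n in sequentially. c * (1 - r n) < min \<eta> (\<delta> / 2)"
      by (rule order_tendstoD) (use \<eta> \<delta> in simp)
    then obtain N' where N': "\<And>n. n \<ge> N' \<Longrightarrow> c * (1 - r n) < min \<eta> (\<delta> / 2)"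
      unfolding eventually_sequentially by blast
    \<comment> \<open>Every parameter is fixed before \<open>n\<close>; the threshold
      \<open>max N N'\<close> makes the index both as late as demanded and late enough for the
      displacement bound.\<close>
    have "(q, j, d, m, max N N', k) \<in> I" using q(1) d by (simp add: I_def)
    then have "f \<in> G (q, j, d, m, max N N', k)" using f by blast
    then obtain n where n: "n \<ge> N" "n \<ge> N'"
      "\<And>z. z \<in> cut_annulus (r n) c p (inverse (real (Suc m))) \<Longrightarrow> cmod (f z - poly q z) < inverse (real (Suc k))"
      by (auto simp: G_def approx_on_cut_annulus_def c_def p_def)
    have "cmod (compose (ball 0 1) f \<Phi> (of_real (r n) * \<zeta>) - \<phi> \<zeta>) < e" if \<zeta>: "\<zeta> \<in> K" for \<zeta>
    proof -
      have \<zeta>1: "cmod \<zeta> = 1" using \<zeta> K(2) by auto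
      define x where "x = of_real (r n) * \<zeta>"
      have x: "x \<in> ball 0 1" using \<zeta>1 r by (simp add: x_def norm_mult)
      have "inverse (real (Suc m)) + c * (1 - r n) \<le> cmod (M \<zeta> - p)"
        using m N'[OF n(2)] \<delta>(2)[of "M \<zeta>"] \<zeta> by simp
      then have Mx: "M x \<in> cut_annulus (r n) c p (inverse (real (Suc m)))"
        and near: "cmod (M x - M \<zeta>) \<le> c * (1 - r n)"
        using disc_automorphism_hits_cut_annulus[OF M(3,4,2,5,6,7) _ _ \<zeta>1 r, of c] j
        by (auto simp: x_def c_def)
      have M1: "cmod (M x) \<le> 1" "cmod (M \<zeta>) \<le> 1"
        using M(2,3) x \<zeta>1 by (auto simp: image_subset_iff less_imp_le)
      have "cmod (f (M x) - poly q (M x)) < e / 4" using n(3)[OF Mx] k by simp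
      moreover have "cmod (poly q (M x) - poly q (M \<zeta>)) < e / 4"
        using \<eta>(2)[of "M \<zeta>" "M x"] M1 near N'[OF n(2)] by simp
      moreover have "cmod (poly q0 (M \<zeta>) - poly q (M \<zeta>)) < e / 4" by (rule q(2)[OF M1(2)])
      moreover have "cmod (\<phi> \<zeta> - poly q0 (M \<zeta>)) < e / 4"
        using q0[of "M \<zeta>"] \<zeta> M(5)[of \<zeta>] \<zeta>1 by simp
      ultimately have "cmod (f (M x) - \<phi> \<zeta>) < e / 4 + e / 4 + (e / 4 + e / 4)"
        by (smt (verit) norm_diff_triangle_less norm_minus_commute)
      then show ?thesis using M(1)[OF x] x by (simp add: compose_def flip: x_def)
    qed
    then show "\<exists>n\<ge>N. \<forall>\<zeta>\<in>K. cmod (compose (ball 0 1) f \<Phi> (of_real (r n) * \<zeta>) - \<phi> \<zeta>) < e"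
      using n(1) by blast
  qed
  ultimately show ?thesis by blast
qed

end
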